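(* Let $n\ge2$ and $\tilde c\in\mathbb{R}$, and let $x:\mathbb{S}^n\to\tilde N^{2n+1}(\tilde c)$ be any one of the contact Whitney spheres in the Sasakian space form $\tilde N^{2n+1}(\tilde c)$ with Sasakian structure $(\varphi,\xi,\eta,g)$. Then the sectional curvatures of the induced metric $x^*g$ on $\mathbb{S}^n$ are not constant. Nevertheless, $(\mathbb{S}^n,x^*g)$ is conformally equivalent to the round sphere, i.e. there are a diffeomorphism $F:\mathbb{S}^n\to\mathbb{S}^n$ and a smooth function $f$ on $\mathbb{S}^n$ such that $F^*(x^*g)=e^{2f}g_0$, where $g_0$ is the standard metric of the unit sphere.
   Context: The Sasakian space forms $\tilde N^{2n+1}(\tilde c)$ of constant $\varphi$-sectional curvature $\tilde c$ are the following standard models. ($\tilde c=-3$) $\mathbb{R}^{2n+1}$ with coordinates $(x_1,\ldots,x_n,y_1,\ldots,y_n,z)$, $\xi=2\partial_z$, $\eta=\frac12(dz-\sum_i y_idx_i)$, $g=\eta\otimes\eta+\frac14\sum_i(dx_i^2+dy_i^2)$, $\varphi(\sum_i(X_i\partial_{x_i}+Y_i\partial_{y_i})+Z\partial_z)=\sum_i(Y_i\partial_{x_i}-X_i\partial_{y_i})+\sum_iY_iy_i\partial_z$. ($\tilde c>-3$) The unit sphere $\mathbb{S}^{2n+1}\subset\mathbb{C}^{n+1}$. Let $\bar g$ be the induced metric, $J$ the complex structure of $\mathbb{C}^{n+1}$, $N$ the unit normal $N(p)=-p$, $\bar\xi=JN$, $\bar\eta=\bar g(\cdot,\bar\xi)$,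 $\bar\varphi X=JX-\langle JX,N\rangle N$ with $\langle\cdot,\cdot\rangle$ the real Euclidean inner product. Put $\eta=a\bar\eta$, $\xi=\frac1a\bar\xi$, $\varphi=\bar\varphi$, $g=a\bar g+a(a-1)\bar\eta\otimes\bar\eta$, where $a>0$ and $\tilde c=\frac4a-3$. ($\tilde c<-3$) $\mathbb{B}^n\times\mathbb{R}$, where $\mathbb{B}^n=\{z\in\mathbb{C}^n:\|z\|<1\}$ has the Bergman metric $\tilde g=4\{\frac{1}{1-\|z\|^2}\sum_idz_id\bar z_i+\frac{1}{(1-\|z\|^2)^2}\sum_{i,j}z_i\bar z_jdz_jd\bar z_i\}$ (a Kähler metric of holomorphic sectional curvature $-1$). With $t$ the coordinate on $\mathbb{R}$ and $\omega=\frac{2\sqrt{-1}}{1-\|z\|^2}\sum_j(\bar z_jdz_j-z_jd\bar z_j)$, put $\bar\eta=\omega+dt$, $\bar\xi=\partial_t$, $\bar g=\tilde g+\bar\eta\otimes\bar\eta$, and let $\bar\varphi$ be the horizontal lift of the complex structure of $\mathbb{B}^n$ (so $\bar\varphi\bar\xi=0$, $\bar\eta\circ\bar\varphi=0$, and $\bar\varphi$ projects to the complex structure). Then $\eta=a\bar\eta$, $\xi=\frac1a\bar\xi$, $\varphi=\bar\varphi$, $g=a\bar g+a(a-1)\bar\eta\otimes\bar\eta$, where $a>0$ and $\tilde c=-\frac1a-3$. An immersion $x$ of an $n$-manifold into $\tilde N^{2n+1}(\tilde c)$ is Legendrian if $x^*\eta=0$. Contact Whitney spheres: they are the following Legendrian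 immersions of the unit sphere $\mathbb{S}^n\subset\mathbb{R}^{n+1}$ (up to automorphisms of the Sasakian space form, i.e. isometries preserving $\varphi,\xi,\eta$). ($\tilde c=-3$) With $u=(u_0,\ldots,u_n)\in\mathbb{S}^n$: $\tilde\Psi_{B,b,r}(u)=\frac{r}{1+u_0^2}\left(u_0u_1,\ldots,u_0u_n,u_1,\ldots,u_n,\frac{ru_0}{1+u_0^2}+b(1+u_0^2)\right)+B$, with $r>0$, $b\in\mathbb{R}$, and $B\in\mathbb{R}^{2n+1}$ with vanishing $y$-components. ($\tilde c>-3$) With $u=(u_1,\ldots,u_{n+1})\in\mathbb{S}^n$ and $\theta>0$: $\tilde\Psi_\theta(u)=\left(\frac{(u_1,\ldots,u_n)}{\cosh\theta+i\sinh\theta\,u_{n+1}};\ \frac{\sinh\theta\cosh\theta(1+u_{n+1}^2)+iu_{n+1}}{\cosh^2\theta+\sinh^2\theta\,u_{n+1}^2}\right)\in\mathbb{S}^{2n+1}$. ($\tilde c<-3$) Legendrian immersions $\tilde\Phi_\theta:\mathbb{S}^n\to\mathbb{B}^n\times\mathbb{R}$, $\theta>0$, with $\pi(\tilde\Phi_\theta(u))=\Pi\left(\frac{(u_1,\ldots,u_n)}{\sinh\theta+i\cosh\theta\,u_{n+1}};\ \frac{\sinh\theta\cosh\theta(1+u_{n+1}^2)-iu_{n+1}}{\sinh^2\theta+\cosh^2\theta\,u_{n+1}^2}\right)$, where $\pi:\mathbb{B}^n\times\mathbb{R}\to\mathbb{B}^n$ is the projection and $\Pi:\{z\in\mathbb{C}^{n+1}:\sum_{i=1}^n|z_i|^2-|z_{n+1}|^2=-1\}\to\mathbb{B}^n$,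 $\Pi(z)=(z_1,\ldots,z_n)/z_{n+1}$, is the Hopf projection onto complex hyperbolic space in the ball model. *)

theory Defs
  imports "HOL-Analysis.Analysis"
begin

section \<open>Smooth maps and tangent vectors on subsets of Euclidean spaces\<close>

primrec Ck_on :: "nat \<Rightarrow> 'a::real_normed_vector set \<Rightarrow> ('a \<Rightarrow> 'b::real_normed_vector) \<Rightarrow> bool" where
  "Ck_on 0 U f \<longleftrightarrow> continuous_on U f"
| "Ck_on (Suc k) U f \<longleftrightarrow> (\<forall>p\<in>U. f differentiable at p) \<and>
     (\<forall>v. Ck_on k U (\<lambda>p. frechet_derivative f (at p) v))"

text \<open>On an arbitrary subset, in particular an embedded submanifold, smoothness means local
  extendability to smooth maps of the ambient space; on open sets this is the usual notion.\<close>

definition smooth_on :: "'a::real_normed_vector set \<Rightarrow> ('a \<Rightarrow> 'b::real_normed_vector) \<Rightarrow> bool" where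
  "smooth_on S f \<longleftrightarrow> (\<forall>p\<in>S. \<exists>U g. open U \<and> p \<in> U \<and> (\<forall>k. Ck_on k U g) \<and> (\<forall>q\<in>U \<inter> S. g q = f q))"

definition diffeomorphism_on :: "'a::real_normed_vector set \<Rightarrow> 'b::real_normed_vector set \<Rightarrow> ('a \<Rightarrow> 'b) \<Rightarrow> bool" where
  "diffeomorphism_on S T f \<longleftrightarrow> bij_betw f S T \<and> smooth_on S f \<and> smooth_on T (inv_into S f)"

text \<open>The set of velocities of curves in \<open>S\<close> through \<open>p\<close>; the tangent space if \<open>S\<close> is an embedded
  submanifold.\<close>

definition tangent_space :: "'a::real_normed_vector set \<Rightarrow> 'a \<Rightarrow> 'a set" where
  "tangent_space S p =
     {X. \<exists>c::real \<Rightarrow> 'a. c 0 = p \<and> range c \<subseteq> S \<and> (c has_vector_derivative X) (at 0)}"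

text \<open>The derivative within \<open>S\<close> is not unique in directions transversal to \<open>S\<close>, but it is unique on
  \<open>tangent_space S p\<close>. It is only ever used there, and it does not depend on the values of \<open>f\<close> off \<open>S\<close>.\<close>

definition differential :: "'a::real_normed_vector set \<Rightarrow> ('a \<Rightarrow> 'b::real_normed_vector) \<Rightarrow> 'a \<Rightarrow> 'a \<Rightarrow> 'b" where
  "differential S f p = frechet_derivative f (at p within S)"

text \<open>A metric is a map taking a point and two tangent vectors at that point.\<close>

type_synonym 'a metric_tensor = "'a \<Rightarrow> 'a \<Rightarrow> 'a \<Rightarrow> real"

definition pullback :: "'a::real_normed_vector set \<Rightarrow> ('a \<Rightarrow> 'b::real_normed_vector) \<Rightarrow> 'b metric_tensor \<Rightarrow> 'a metric_tensor" where
  "pullback S f g p X Y = g (f p) (differential S f p X) (differential S f p Y)"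

section \<open>Sectional curvature\<close>

definition partial :: "'n \<Rightarrow> (real^'n::finite \<Rightarrow> real) \<Rightarrow> real^'n \<Rightarrow> real" where
  "partial i h w = frechet_derivative h (at w) (axis i 1)"

definition gram :: "(real^'n::finite) metric_tensor \<Rightarrow> real^'n \<Rightarrow> real^'n^'n" where
  "gram g w = (\<chi> i j. g w (axis i 1) (axis j 1))"

definition christoffel :: "(real^'n::finite) metric_tensor \<Rightarrow> 'n \<Rightarrow> 'n \<Rightarrow> 'n \<Rightarrow> real^'n \<Rightarrow> real" where
  "christoffel g k i j w = (1/2) * (\<Sum>l\<in>UNIV. matrix_inv (gram g w) $ k $ l *
     (partial i (\<lambda>w. gram g w $ j $ l) w + partial j (\<lambda>w. gram g w $ i $ l) w
       - partial l (\<lambda>w. gram g w $ i $ j) w))"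

text \<open>\<open>riemann g l i j k\<close> is the \<open>l\<close>-th component of \<open>R(\<partial>\<^sub>i, \<partial>\<^sub>j)\<partial>\<^sub>k\<close>, where
  \<open>R(X, Y) = [\<nabla>\<^sub>X, \<nabla>\<^sub>Y] - \<nabla>\<^bsub>[X,Y]\<^esub>\<close>.\<close>

definition riemann :: "(real^'n::finite) metric_tensor \<Rightarrow> 'n \<Rightarrow> 'n \<Rightarrow> 'n \<Rightarrow> 'n \<Rightarrow> real^'n \<Rightarrow> real" where
  "riemann g l i j k w =
     partial i (christoffel g l j k) w - partial j (christoffel g l i k) w
     + (\<Sum>m\<in>UNIV. christoffel g l i m w * christoffel g m j k w
                  - christoffel g l j m w * christoffel g m i k w)"

definition curvature_operator ::
    "(real^'n::finite) metric_tensor \<Rightarrow> real^'n \<Rightarrow> real^'n \<Rightarrow> real^'n \<Rightarrow> real^'n \<Rightarrow> real^'n" where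
  "curvature_operator g w X Y Z =
     (\<chi> l. \<Sum>i\<in>UNIV. \<Sum>j\<in>UNIV. \<Sum>k\<in>UNIV. riemann g l i j k w * X$i * Y$j * Z$k)"

definition sectional_curvature :: "(real^'n::finite) metric_tensor \<Rightarrow> real^'n \<Rightarrow> real^'n \<Rightarrow> real^'n \<Rightarrow> real" where
  "sectional_curvature g w X Y =
     g w (curvature_operator g w X Y Y) X / (g w X X * g w Y Y - (g w X Y)\<^sup>2)"

text \<open>The unit sphere of \<open>\<real>\<^sup>n\<^sup>+\<^sup>1\<close>, the latter being split as \<open>\<real>\<^sup>n \<times> \<real>\<close>.\<close>

type_synonym 'n real_space = "(real^'n) \<times> real"

abbreviation unit_sphere :: "'n::finite real_space set" where
  "unit_sphere \<equiv> sphere 0 1"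

definition local_parametrization :: "(real^'n::finite) set \<Rightarrow> (real^'n \<Rightarrow> 'n real_space) \<Rightarrow> bool" where
  "local_parametrization U \<phi> \<longleftrightarrow> open U \<and> openin (top_of_set unit_sphere) (\<phi> ` U)
     \<and> diffeomorphism_on U (\<phi> ` U) \<phi>"

definition constant_sectional_curvature :: "'n::finite real_space metric_tensor \<Rightarrow> bool" where
  "constant_sectional_curvature G \<longleftrightarrow>
     (\<exists>\<kappa>. \<forall>U \<phi>. local_parametrization U \<phi> \<longrightarrow>
        (\<forall>w\<in>U. \<forall>X Y. X \<noteq> Y \<and> independent {X, Y} \<longrightarrow>
           sectional_curvature (pullback U \<phi> G) w X Y = \<kappa>))"

definition conformally_equivalent_to_round :: "'n::finite real_space metric_tensor \<Rightarrow> bool" where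
  "conformally_equivalent_to_round G \<longleftrightarrow>
     (\<exists>(F :: 'n real_space \<Rightarrow> 'n real_space) (f :: 'n real_space \<Rightarrow> real).
        diffeomorphism_on unit_sphere unit_sphere F \<and> smooth_on unit_sphere f \<and>
        (\<forall>p\<in>unit_sphere. \<forall>X\<in>tangent_space unit_sphere p. \<forall>Y\<in>tangent_space unit_sphere p.
           pullback unit_sphere F G p X Y = exp (2 * f p) * (X \<bullet> Y)))"

section \<open>Sasakian space forms\<close>

record 'a contact_metric_manifold =
  points :: "'a set"
  phi :: "'a \<Rightarrow> 'a \<Rightarrow> 'a"
  reeb :: "'a \<Rightarrow> 'a"
  contact_form :: "'a \<Rightarrow> 'a \<Rightarrow> real"
  metric :: "'a metric_tensor"

definition automorphism :: "('a::real_normed_vector) contact_metric_manifold \<Rightarrow> ('a \<Rightarrow> 'a) \<Rightarrow> bool" where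
  "automorphism M A \<longleftrightarrow> diffeomorphism_on (points M) (points M) A \<and>
     (\<forall>p\<in>points M. differential (points M) A p (reeb M p) = reeb M (A p) \<and>
        (\<forall>X\<in>tangent_space (points M) p.
           contact_form M (A p) (differential (points M) A p X) = contact_form M p X \<and>
           phi M (A p) (differential (points M) A p X) = differential (points M) A p (phi M p X) \<and>
           (\<forall>Y\<in>tangent_space (points M) p. pullback (points M) A (metric M) p X Y = metric M p X Y)))"

definition legendrian_immersion ::
    "('a::real_normed_vector) contact_metric_manifold \<Rightarrow> ('n::finite real_space \<Rightarrow> 'a) \<Rightarrow> bool" where
  "legendrian_immersion M x \<longleftrightarrow> x ` unit_sphere \<subseteq> points M \<and> smooth_on unit_sphere x \<and>
     (\<forall>p\<in>unit_sphere. inj_on (differential unit_sphere x p) (tangent_space unit_sphere p) \<and>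
        (\<forall>X\<in>tangent_space unit_sphere p. contact_form M (x p) (differential unit_sphere x p X) = 0))"

text \<open>\<open>\<real>\<^bsup>2n+1\<^esup>\<close> with coordinates \<open>(x, y, z)\<close>, of constant \<open>\<phi>\<close>-sectional curvature \<open>-3\<close>.\<close>

type_synonym 'n flat_space = "(real^'n) \<times> (real^'n) \<times> real"

definition flat_eta :: "'n::finite flat_space \<Rightarrow> 'n flat_space \<Rightarrow> real" where
  "flat_eta = (\<lambda>(x, y, z) (X, Y, Z). (1/2) * (Z - y \<bullet> X))"

definition flat_model :: "'n::finite flat_space contact_metric_manifold" where
  "flat_model = \<lparr>points = UNIV,
     phi = (\<lambda>(x, y, z) (X, Y, Z). (Y, - X, Y \<bullet> y)),
     reeb = (\<lambda>_. (0, 0, 2)),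
     contact_form = flat_eta,
     metric = (\<lambda>p V W. flat_eta p V * flat_eta p W
                + (1/4) * (fst V \<bullet> fst W + fst (snd V) \<bullet> fst (snd W)))\<rparr>"

text \<open>The unit sphere of \<open>\<complex>\<^bsup>n+1\<^esup> = \<complex>\<^sup>n \<times> \<complex>\<close>. The inner product of these complex spaces is the real
  Euclidean one.\<close>

type_synonym 'n complex_space = "(complex^'n) \<times> complex"

definition J :: "'n::finite complex_space \<Rightarrow> 'n complex_space" where
  "J = (\<lambda>(z, w). (\<i> *s z, \<i> * w))"

definition sphere_normal :: "'n::finite complex_space \<Rightarrow> 'n complex_space" where
  "sphere_normal p = - p"

definition sphere_eta :: "'n::finite complex_space \<Rightarrow> 'n complex_space \<Rightarrow> real" where
  "sphere_eta p X = X \<bullet> J (sphere_normal p)"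

definition sphere_model :: "real \<Rightarrow> 'n::finite complex_space contact_metric_manifold" where
  "sphere_model a = \<lparr>points = sphere 0 1,
     phi = (\<lambda>p X. J X - (J X \<bullet> sphere_normal p) *\<^sub>R sphere_normal p),
     reeb = (\<lambda>p. (1/a) *\<^sub>R J (sphere_normal p)),
     contact_form = (\<lambda>p X. a * sphere_eta p X),
     metric = (\<lambda>p X Y. a * (X \<bullet> Y) + a * (a - 1) * sphere_eta p X * sphere_eta p Y)\<rparr>"

text \<open>The product of the open unit ball of \<open>\<complex>\<^sup>n\<close> with \<open>\<real>\<close>. The products of \<open>dz\<^sub>i\<close> with conjugates of
  \<open>dz\<^sub>j\<close> in the Bergman metric are symmetrised, so
  polarising the quadratic form gives real parts.\<close>

type_synonym 'n ball_space = "(complex^'n) \<times> real"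

definition bergman_metric :: "(complex^'n::finite) metric_tensor" where
  "bergman_metric z X Y = 4 * Re (
     complex_of_real (1 / (1 - (norm z)\<^sup>2)) * (\<Sum>i\<in>UNIV. X$i * cnj (Y$i))
     + complex_of_real (1 / (1 - (norm z)\<^sup>2)\<^sup>2)
        * (\<Sum>i\<in>UNIV. \<Sum>j\<in>UNIV. z$i * cnj (z$j) * X$j * cnj (Y$i)))"

text \<open>The form is real valued: the sum below is purely imaginary.\<close>

definition ball_omega :: "complex^'n::finite \<Rightarrow> complex^'n \<Rightarrow> real" where
  "ball_omega z X = Re (2 * \<i> / complex_of_real (1 - (norm z)\<^sup>2)
     * (\<Sum>j\<in>UNIV. cnj (z$j) * X$j - z$j * cnj (X$j)))"

definition ball_eta :: "'n::finite ball_space \<Rightarrow> 'n ball_space \<Rightarrow> real" where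
  "ball_eta p V = ball_omega (fst p) (fst V) + snd V"

text \<open>The horizontal lift of \<open>X\<close> at \<open>(z, t)\<close> is \<open>(X, - \<omega>\<^sub>z X)\<close>.\<close>

definition ball_model :: "real \<Rightarrow> 'n::finite ball_space contact_metric_manifold" where
  "ball_model a = \<lparr>points = {z. norm z < 1} \<times> UNIV,
     phi = (\<lambda>p V. (\<i> *s fst V, - ball_omega (fst p) (\<i> *s fst V))),
     reeb = (\<lambda>_. (1/a) *\<^sub>R (0, 1)),
     contact_form = (\<lambda>p V. a * ball_eta p V),
     metric = (\<lambda>p V W. a * (bergman_metric (fst p) (fst V) (fst W) + ball_eta p V * ball_eta p W)
                + a * (a - 1) * ball_eta p V * ball_eta p W)\<rparr>"

section \<open>Contact Whitney spheres\<close>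

text \<open>A point of the unit sphere is written \<open>(v, s)\<close>. In the flat model \<open>s\<close> is the coordinate \<open>u\<^sub>0\<close> and
  \<open>v = (u\<^sub>1, \<dots>, u\<^sub>n)\<close>; in the other two models \<open>s\<close> is \<open>u\<^bsub>n+1\<^esub>\<close>.\<close>

definition flat_whitney :: "'n::finite flat_space \<Rightarrow> real \<Rightarrow> real \<Rightarrow> 'n real_space \<Rightarrow> 'n flat_space" where
  "flat_whitney B b r = (\<lambda>(v, s).
     (r / (1 + s\<^sup>2)) *\<^sub>R (s *\<^sub>R v, v, r * s / (1 + s\<^sup>2) + b * (1 + s\<^sup>2)) + B)"

definition sphere_whitney :: "real \<Rightarrow> 'n::finite real_space \<Rightarrow> 'n complex_space" where
  "sphere_whitney \<theta> = (\<lambda>(v, s).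
     (\<chi> i. complex_of_real (v$i) / (complex_of_real (cosh \<theta>) + \<i> * complex_of_real (sinh \<theta> * s)),
      (complex_of_real (sinh \<theta> * cosh \<theta> * (1 + s\<^sup>2)) + \<i> * complex_of_real s)
        / complex_of_real ((cosh \<theta>)\<^sup>2 + (sinh \<theta>)\<^sup>2 * s\<^sup>2)))"

definition hopf_projection :: "'n::finite complex_space \<Rightarrow> complex^'n" where
  "hopf_projection = (\<lambda>(z, w). \<chi> i. z$i / w)"

definition hyperbolic_whitney :: "real \<Rightarrow> 'n::finite real_space \<Rightarrow> 'n complex_space" where
  "hyperbolic_whitney \<theta> = (\<lambda>(v, s).
     (\<chi> i. complex_of_real (v$i) / (complex_of_real (sinh \<theta>) + \<i> * complex_of_real (cosh \<theta> * s)),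
      (complex_of_real (sinh \<theta> * cosh \<theta> * (1 + s\<^sup>2)) - \<i> * complex_of_real s)
        / complex_of_real ((sinh \<theta>)\<^sup>2 + (cosh \<theta>)\<^sup>2 * s\<^sup>2)))"

definition congruent_on_sphere ::
    "('a::real_normed_vector) contact_metric_manifold \<Rightarrow> ('n::finite real_space \<Rightarrow> 'a) \<Rightarrow> ('n real_space \<Rightarrow> 'a) \<Rightarrow> bool" where
  "congruent_on_sphere M \<psi> x \<longleftrightarrow> (\<exists>A. automorphism M A \<and> (\<forall>u\<in>unit_sphere. x u = A (\<psi> u)))"

definition flat_contact_whitney_sphere :: "('n::finite real_space \<Rightarrow> 'n flat_space) \<Rightarrow> bool" where
  "flat_contact_whitney_sphere x \<longleftrightarrow>
     (\<exists>r b B. r > 0 \<and> fst (snd B) = 0 \<and> congruent_on_sphere flat_model (flat_whitney B b r) x)"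

definition sphere_contact_whitney_sphere :: "real \<Rightarrow> ('n::finite real_space \<Rightarrow> 'n complex_space) \<Rightarrow> bool" where
  "sphere_contact_whitney_sphere a x \<longleftrightarrow>
     (\<exists>\<theta>>0. congruent_on_sphere (sphere_model a) (sphere_whitney \<theta>) x)"

definition ball_contact_whitney_sphere :: "real \<Rightarrow> ('n::finite real_space \<Rightarrow> 'n ball_space) \<Rightarrow> bool" where
  "ball_contact_whitney_sphere a x \<longleftrightarrow>
     (\<exists>\<theta>>0. \<exists>\<psi>. legendrian_immersion (ball_model a) \<psi> \<and>
        (\<forall>u\<in>unit_sphere. fst (\<psi> u) = hopf_projection (hyperbolic_whitney \<theta> u)) \<and>
        congruent_on_sphere (ball_model a) \<psi> x)"

end

theory Submission
  imports Defs
begin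

text \<open>Automorphisms preserve the metric, so only the model maps matter. On vectors tangent to the
  sphere all three induce the metric \<open>A / (\<alpha> + \<beta> s\<^sup>2) g\<^sub>0\<close> at \<open>(v, s)\<close> with positive
  constants: \<open>A = r\<^sup>2/4\<close>, \<open>\<alpha> = \<beta> = 1\<close> in the flat case, \<open>A = a\<close>,
  \<open>\<alpha> = cosh\<^sup>2 \<theta>\<close>, \<open>\<beta> = sinh\<^sup>2 \<theta>\<close> in the spherical case, and \<open>A = 4a\<close>,
  \<open>\<alpha> = sinh\<^sup>2 \<theta>\<close>, \<open>\<beta> = cosh\<^sup>2 \<theta>\<close> in the ball. Hence the identity is the required
  conformal diffeomorphism. In the stereographic chart the metric is \<open>|dw|\<^sup>2 / F(|w|\<^sup>2)\<close> with
  \<open>4 A F(\<rho>) = \<alpha> (1 + \<rho>)\<^sup>2 + \<beta> (1 - \<rho>)\<^sup>2\<close>; its sectional curvature is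
  \<open>(\<alpha> - \<beta>) / A\<close> at the pole, but \<open>(\<alpha> + \<beta>) / A\<close> at the equator in planes containing the
  radial direction.\<close>

section \<open>Calculus of smooth maps\<close>

lemma has_derivative_cong_open:
  assumes "open U" "p \<in> U" "\<And>x. x \<in> U \<Longrightarrow> f x = g x"
  shows "(f has_derivative D) (at p) \<longleftrightarrow> (g has_derivative D) (at p)"
proof
  assume "(f has_derivative D) (at p)"
  then show "(g has_derivative D) (at p)"
    by (rule has_derivative_transform_within_open[OF _ assms(1,2)]) (simp add: assms(3))
next
  assume "(g has_derivative D) (at p)"
  then show "(f has_derivative D) (at p)"
    by (rule has_derivative_transform_within_open[OF _ assms(1,2)]) (simp add: assms(3))
qed

lemma Ck_on_cong:
  assumes "open U" "\<And>x. x \<in> U \<Longrightarrow> f x = g x"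
  shows "Ck_on k U f \<longleftrightarrow> Ck_on k U g"
  using assms(2)
proof (induction k arbitrary: f g)
  case 0
  then show ?case by (simp cong: continuous_on_cong)
next
  case (Suc k)
  have D: "(f has_derivative D) (at p) \<longleftrightarrow> (g has_derivative D) (at p)" if "p \<in> U" for p D
    by (rule has_derivative_cong_open[OF assms(1) that Suc.prems])
  then have "frechet_derivative f (at p) v = frechet_derivative g (at p) v" if "p \<in> U" for p v
    using that by (simp add: frechet_derivative_def)
  then have "Ck_on k U (\<lambda>p. frechet_derivative f (at p) v)
      \<longleftrightarrow> Ck_on k U (\<lambda>p. frechet_derivative g (at p) v)" for v
    by (rule Suc.IH)
  then show ?case using D by (simp add: differentiable_def)
qed

text \<open>Lets an explicit derivative formula replace \<open>frechet_derivative\<close>: the two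
  agree by uniqueness at every point of \<open>U\<close>, and \<open>Ck_on\<close> only looks at
  values on an open \<open>U\<close>.\<close>

lemma Ck_on_SucI:
  assumes "open U" "\<And>p. p \<in> U \<Longrightarrow> (f has_derivative D p) (at p)"
    and "\<And>v. Ck_on k U (\<lambda>p. D p v)"
  shows "Ck_on (Suc k) U f"
proof -
  have "frechet_derivative f (at p) = D p" if "p \<in> U" for p
    using frechet_derivative_at[OF assms(2)[OF that]] by simp
  then have "Ck_on k U (\<lambda>p. frechet_derivative f (at p) v) \<longleftrightarrow> Ck_on k U (\<lambda>p. D p v)" for v
    by (intro Ck_on_cong[OF assms(1)]) simp
  then show ?thesis
    using assms(2,3) by (auto simp: differentiable_def)
qed

lemma Ck_on_SucD:
  assumes "Ck_on (Suc k) U f"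
  shows "\<And>p. p \<in> U \<Longrightarrow> (f has_derivative frechet_derivative f (at p)) (at p)"
    and "\<And>v. Ck_on k U (\<lambda>p. frechet_derivative f (at p) v)"
  using assms by (auto simp: frechet_derivative_works)

text \<open>At the base, differentiability gives continuity. The product rule leaves
  undifferentiated factors, and this lemma lowers their order to that of the differentiated
  ones.\<close>

lemma Ck_on_lower: "Ck_on (Suc k) U f \<Longrightarrow> Ck_on k U f"
proof (induction k arbitrary: f)
  case 0
  then show ?case
    by (auto intro!: continuous_at_imp_continuous_on differentiable_imp_continuous_within)
next
  case (Suc k)
  have "Ck_on k U (\<lambda>p. frechet_derivative f (at p) v)" for v
    by (rule Suc.IH[OF Ck_on_SucD(2)[OF Suc.prems]])
  then show ?case using Suc.prems by simp
qed

lemma Ck_on_const: "Ck_on k U (\<lambda>_. c)"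
  by (induction k arbitrary: c) (auto simp: frechet_derivative_const)

lemma Ck_on_linear:
  assumes "bounded_linear L"
  shows "Ck_on k U L"
proof (cases k)
  case 0
  then show ?thesis using assms by (auto intro: linear_continuous_on)
next
  case (Suc m)
  have "frechet_derivative L (at p) = L" for p
    by (rule frechet_derivative_at[symmetric]) (rule bounded_linear_imp_has_derivative[OF assms])
  then show ?thesis
    using Suc bounded_linear_imp_differentiable[OF assms] by (auto simp: Ck_on_const)
qed

lemma Ck_on_add:
  assumes "open U" "Ck_on k U f" "Ck_on k U g"
  shows "Ck_on k U (\<lambda>x. f x + g x)"
  using assms(2,3)
proof (induction k arbitrary: f g)
  case 0
  then show ?case by (auto intro: continuous_on_add)
next
  case (Suc k)
  show ?case
  proof (rule Ck_on_SucI[OF assms(1)])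
    show "((\<lambda>x. f x + g x) has_derivative
        (\<lambda>v. frechet_derivative f (at p) v + frechet_derivative g (at p) v)) (at p)"
      if "p \<in> U" for p
      by (intro has_derivative_add Ck_on_SucD(1)[OF Suc.prems(1)] Ck_on_SucD(1)[OF Suc.prems(2)] that)
  qed (intro Suc.IH Ck_on_SucD(2)[OF Suc.prems(1)] Ck_on_SucD(2)[OF Suc.prems(2)])
qed

text \<open>Covers products, scalings and inner products at once: the product rule gives a sum of
  two terms of the same bilinear shape, so the induction runs over all pairs of factors.\<close>

lemma Ck_on_bilinear:
  assumes "bounded_bilinear B" "open U" "Ck_on k U f" "Ck_on k U g"
  shows "Ck_on k U (\<lambda>x. B (f x) (g x))"
  using assms(3,4)
proof (induction k arbitrary: f g)
  case 0
  then show ?case by (auto intro: bounded_bilinear.continuous_on[OF assms(1)])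
next
  case (Suc k)
  show ?case
  proof (rule Ck_on_SucI[OF assms(2)])
    show "((\<lambda>x. B (f x) (g x)) has_derivative
        (\<lambda>v. B (f p) (frechet_derivative g (at p) v) + B (frechet_derivative f (at p) v) (g p))) (at p)"
      if "p \<in> U" for p
      by (intro bounded_bilinear.FDERIV[OF assms(1)] Ck_on_SucD(1)[OF Suc.prems(1)]
          Ck_on_SucD(1)[OF Suc.prems(2)] that)
    show "Ck_on k U (\<lambda>p. B (f p) (frechet_derivative g (at p) v)
        + B (frechet_derivative f (at p) v) (g p))" for v
      by (intro Ck_on_add assms(2) Suc.IH Ck_on_SucD(2)[OF Suc.prems(1)]
          Ck_on_SucD(2)[OF Suc.prems(2)] Ck_on_lower[OF Suc.prems(1)] Ck_on_lower[OF Suc.prems(2)])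
  qed
qed

text \<open>The derivative - f' / f^2 contains only f' and 1/f again; the induction hypothesis for
  the fixed f supplies the latter, and no formula for higher derivatives is required.\<close>

lemma Ck_on_inverse:
  fixes f :: "'a::real_normed_vector \<Rightarrow> real"
  assumes "open U" "Ck_on k U f" "\<And>x. x \<in> U \<Longrightarrow> f x \<noteq> 0"
  shows "Ck_on k U (\<lambda>x. inverse (f x))"
  using assms(2,3)
proof (induction k)
  case 0
  then show ?case by (auto intro: continuous_on_inverse)
next
  case (Suc k)
  have IH: "Ck_on k U (\<lambda>x. inverse (f x))" using Suc Ck_on_lower by blast
  show ?case
  proof (rule Ck_on_SucI[OF assms(1)])
    fix p assume p: "p \<in> U"
    show "((\<lambda>x. inverse (f x)) has_derivative
        (\<lambda>v. - 1 * (inverse (f p) * frechet_derivative f (at p) v * inverse (f p)))) (at p)"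
      using Deriv.has_derivative_inverse[OF _ Ck_on_SucD(1)[OF Suc.prems(1) p]] Suc.prems(2)[OF p]
      by simp
  next
    fix v
    show "Ck_on k U (\<lambda>p. - 1 * (inverse (f p) * frechet_derivative f (at p) v * inverse (f p)))"
      by (intro Ck_on_bilinear[OF bounded_bilinear_mult] assms(1) Ck_on_const IH
          Ck_on_SucD(2)[OF Suc.prems(1)])
  qed
qed

lemma Ck_on_ln:
  fixes f :: "'a::real_normed_vector \<Rightarrow> real"
  assumes "open U" "Ck_on k U f" "\<And>x. x \<in> U \<Longrightarrow> f x > 0"
  shows "Ck_on k U (\<lambda>x. ln (f x))"
proof (cases k)
  case 0
  then show ?thesis using assms by (force intro: continuous_on_ln)
next
  case (Suc m)
  note f = assms(2)[unfolded Suc]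
  show ?thesis unfolding Suc
  proof (rule Ck_on_SucI[OF assms(1)])
    fix p assume p: "p \<in> U"
    show "((\<lambda>x. ln (f x)) has_derivative
        (\<lambda>v. frechet_derivative f (at p) v * inverse (f p))) (at p)"
      using has_derivative_ln[OF assms(3)[OF p] Ck_on_SucD(1)[OF f p]] by simp
  next
    fix v
    have "f x \<noteq> 0" if "x \<in> U" for x using assms(3)[OF that] by simp
    then show "Ck_on m U (\<lambda>p. frechet_derivative f (at p) v * inverse (f p))"
      by (intro Ck_on_bilinear[OF bounded_bilinear_mult] assms(1) Ck_on_inverse
          Ck_on_SucD(2)[OF f] Ck_on_lower[OF f])
  qed
qed

section \<open>Smoothness on subsets through ambient extensions\<close>

lemma smooth_onI:
  assumes "open U" "S \<subseteq> U" "\<And>k. Ck_on k U g" "\<And>q. q \<in> S \<Longrightarrow> g q = f q"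
  shows "smooth_on S f"
  using assms unfolding smooth_on_def by blast

lemma smooth_on_id: "smooth_on S id"
  by (rule smooth_onI[of UNIV _ "\<lambda>x. x"])
     (auto intro: Ck_on_linear bounded_linear_ident)

text \<open>A local extension is differentiable in the ambient space and agrees with f on S near p,
  so its derivative serves as a derivative within S.\<close>

lemma smooth_on_imp_differentiable:
  assumes "smooth_on S f" "p \<in> S"
  shows "f differentiable (at p within S)"
proof -
  obtain U g where U: "open U" "p \<in> U" "Ck_on 1 U g" "\<forall>q\<in>U \<inter> S. g q = f q"
    using assms unfolding smooth_on_def by blast
  then obtain D where "(g has_derivative D) (at p)"
    using Ck_on_SucD(1)[of 0 U g p] by auto
  then have "(g has_derivative D) (at p within S)" by (rule has_derivative_at_withinI)
  moreover obtain e where "e > 0" "ball p e \<subseteq> U" using U openE by blast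
  ultimately have "(f has_derivative D) (at p within S)"
    using U(4) assms(2) by (intro has_derivative_transform_within[of g D p S e f])
      (auto simp: dist_commute subset_iff)
  then show ?thesis by (auto simp: differentiable_def)
qed

section \<open>Tangent vectors\<close>

lemma has_vector_derivative_along_curve:
  assumes "(f has_derivative D) (at (c 0) within S)" "range c \<subseteq> S"
    and "(c has_vector_derivative X) (at 0)"
  shows "((\<lambda>t. f (c t)) has_vector_derivative D X) (at 0)"
proof -
  have "(f has_derivative D) (at (c 0) within range c)"
    by (rule has_derivative_subset[OF assms(1,2)])
  from diff_chain_within[OF assms(3)[unfolded has_vector_derivative_def] this]
  show ?thesis
    using bounded_linear.linear[OF has_derivative_bounded_linear[OF assms(1)]]
    by (simp add: has_vector_derivative_def o_def linear_scale)
qed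

lemma tangent_spaceE:
  assumes "X \<in> tangent_space S p"
  obtains c where "c 0 = p" "range c \<subseteq> S" "(c has_vector_derivative X) (at 0)"
  using assms by (auto simp: tangent_space_def)

text \<open>\<open>differential\<close> is an arbitrary choice among the derivatives within S. Any
  two of them send the velocity of a curve c in S to the velocity of f along c, hence agree on
  tangent vectors.\<close>

lemma differential_eq:
  assumes "(f has_derivative D) (at p within S)" "X \<in> tangent_space S p"
  shows "differential S f p X = D X"
proof -
  have D': "(f has_derivative differential S f p) (at p within S)"
    using differentiableI[OF assms(1)] by (simp add: differential_def frechet_derivative_works)
  obtain c where c: "c 0 = p" "range c \<subseteq> S" "(c has_vector_derivative X) (at 0)"
    using assms(2) by (rule tangent_spaceE)
  show ?thesis
    by (rule vector_derivative_unique_at)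
       (rule has_vector_derivative_along_curve[of f _ c S],
        use c assms(1) D' in simp_all)+
qed

lemma tangent_space_image:
  assumes "(f has_derivative D) (at p within S)" "X \<in> tangent_space S p" "f ` S \<subseteq> T"
  shows "D X \<in> tangent_space T (f p)"
proof -
  obtain c where c: "c 0 = p" "range c \<subseteq> S" "(c has_vector_derivative X) (at 0)"
    using assms(2) by (rule tangent_spaceE)
  have "((\<lambda>t. f (c t)) has_vector_derivative D X) (at 0)"
    using assms(1) c by (intro has_vector_derivative_along_curve[of f D c S]) simp_all
  then show ?thesis using c assms(3) unfolding tangent_space_def
    by (intro CollectI exI[of _ "\<lambda>t. f (c t)"]) auto
qed

lemma tangent_space_UNIV: "X \<in> tangent_space UNIV p"
  unfolding tangent_space_def
  by (intro CollectI exI[of _ "\<lambda>t. p + t *\<^sub>R X"])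
     (auto simp: has_vector_derivative_def intro!: derivative_eq_intros)

text \<open>Differentiating c t \<bullet> c t = 1 along a curve on the sphere gives orthogonality to
  the base point.\<close>

lemma tangent_space_sphere:
  assumes "X \<in> tangent_space (sphere 0 1) p"
  shows "p \<bullet> X = 0"
proof -
  have "((\<lambda>x. x \<bullet> x) has_derivative (\<lambda>X. 2 * (p \<bullet> X))) (at p within sphere 0 1)"
    by (auto intro!: derivative_eq_intros simp: inner_commute)
  moreover obtain c where c: "c 0 = p" "range c \<subseteq> sphere 0 1" "(c has_vector_derivative X) (at 0)"
    using assms by (rule tangent_spaceE)
  ultimately have d: "((\<lambda>t. c t \<bullet> c t) has_vector_derivative 2 * (p \<bullet> X)) (at 0)"
    by (intro has_vector_derivative_along_curve[of "\<lambda>x. x \<bullet> x" "\<lambda>X. 2 * (p \<bullet> X)" c]) simp_all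
  have "c t \<bullet> c t = 1" for t
    using c(2) by (auto simp: dot_square_norm subset_iff)
  then have "((\<lambda>t. 1) has_vector_derivative 2 * (p \<bullet> X)) (at 0)"
    using d by simp
  then have "2 * (p \<bullet> X) = 0"
    using vector_derivative_unique_at has_vector_derivative_const by blast
  then show ?thesis by simp
qed

text \<open>By the chain rule the differential of x is that of A after D. Since D maps into the
  tangent spaces of \<open>points M\<close>, where A preserves the metric, A drops out and only the
  model map remains.\<close>

lemma metric_pullback_congruent:
  assumes "congruent_on_sphere M \<psi> x" "\<psi> ` unit_sphere \<subseteq> points M"
    and "(\<psi> has_derivative D) (at p within unit_sphere)" "p \<in> unit_sphere"
    and X: "X \<in> tangent_space unit_sphere p" and Y: "Y \<in> tangent_space unit_sphere p"
  shows "pullback unit_sphere x (metric M) p X Y = metric M (\<psi> p) (D X) (D Y)"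
proof -
  obtain A where A: "automorphism M A" "\<forall>u\<in>unit_sphere. x u = A (\<psi> u)"
    using assms(1) by (auto simp: congruent_on_sphere_def)
  have p: "\<psi> p \<in> points M" using assms by blast
  define E where "E = differential (points M) A (\<psi> p)"
  have "smooth_on (points M) A"
    using A(1) by (simp add: automorphism_def diffeomorphism_on_def)
  then have E: "(A has_derivative E) (at (\<psi> p) within points M)"
    using smooth_on_imp_differentiable[OF _ p]
    by (simp add: E_def differential_def frechet_derivative_works)
  have "(A \<circ> \<psi> has_derivative E \<circ> D) (at p within unit_sphere)"
    by (rule diff_chain_within[OF assms(3) has_derivative_subset[OF E assms(2)]])
  then have "(x has_derivative E \<circ> D) (at p within unit_sphere)"
    by (rule has_derivative_transform[OF assms(4), rotated]) (use A(2) in auto)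
  then have "differential unit_sphere x p Z = E (D Z)" if "Z \<in> tangent_space unit_sphere p" for Z
    using differential_eq that by fastforce
  moreover have "D Z \<in> tangent_space (points M) (\<psi> p)" if "Z \<in> tangent_space unit_sphere p" for Z
    using tangent_space_image[OF assms(3) that assms(2)] .
  ultimately show ?thesis
    using A p X Y assms(4) by (simp add: automorphism_def pullback_def E_def)
qed

section \<open>Rotationally symmetric conformally flat metrics\<close>

lemma partial_eq:
  assumes "(h has_derivative D) (at w)"
  shows "partial i h w = D (axis i 1)"
  using frechet_derivative_at[OF assms] by (simp add: partial_def)

text \<open>\<open>matrix_inv\<close> is a choice of two-sided inverse, so the value follows from
  existence and uniqueness of that inverse.\<close>

lemma matrix_inv_scaleR_mat:
  assumes "c \<noteq> 0"
  shows "matrix_inv (c *\<^sub>R mat 1 :: real^'n::finite^'n) = inverse c *\<^sub>R mat 1"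
proof -
  have [simp]: "(c *\<^sub>R mat 1) ** B = c *\<^sub>R B" "B ** (c *\<^sub>R mat 1) = c *\<^sub>R B"
    for c and B :: "real^'n^'n"
    by (simp_all add: scalar_matrix_assoc[symmetric] matrix_scalar_ac)
  show ?thesis unfolding matrix_inv_def
  proof (rule some_equality)
    fix B :: "real^'n^'n"
    assume "(c *\<^sub>R mat 1) ** B = mat 1 \<and> B ** (c *\<^sub>R mat 1) = mat 1"
    then have "inverse c *\<^sub>R (c *\<^sub>R B) = inverse c *\<^sub>R mat 1" by simp
    then show "B = inverse c *\<^sub>R mat 1" using assms by simp
  qed (use assms in simp)
qed

context
  fixes F F' F'' :: "real \<Rightarrow> real" and g :: "(real^'n::finite) metric_tensor"
  assumes F_pos: "\<And>\<rho>. F \<rho> > 0"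
    and DF: "\<And>\<rho>. (F has_real_derivative F' \<rho>) (at \<rho>)"
    and DF': "\<And>\<rho>. (F' has_real_derivative F'' \<rho>) (at \<rho>)"
    and g_def: "g = (\<lambda>w X Y. (X \<bullet> Y) / F (w \<bullet> w))"
begin

lemma gram_conformal: "gram g w = (1 / F (w \<bullet> w)) *\<^sub>R mat 1"
  by (simp add: gram_def g_def vec_eq_iff mat_def inner_axis_axis)

lemma has_derivative_radial:
  assumes "\<And>\<rho>. (H has_real_derivative H' \<rho>) (at \<rho>)"
  shows "((\<lambda>w::real^'n. H (w \<bullet> w)) has_derivative (\<lambda>v. H' (w \<bullet> w) * (2 * (w \<bullet> v)))) (at w)"
proof -
  have "((\<lambda>w::real^'n. w \<bullet> w) has_derivative (\<lambda>v. 2 * (w \<bullet> v))) (at w)"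
    by (auto intro!: derivative_eq_intros simp: inner_commute)
  from diff_chain_at[OF this assms[of "w \<bullet> w", THEN has_field_derivative_imp_has_derivative]]
  show ?thesis by (simp add: o_def)
qed

lemma partial_gram:
  "partial i (\<lambda>w. gram g w $ j $ l) w
     = (if j = l then - (2 * F' (w \<bullet> w) * w $ i / (F (w \<bullet> w))\<^sup>2) else 0)"
proof (cases "j = l")
  case True
  have "((\<lambda>\<rho>. 1 / F \<rho>) has_real_derivative - (F' \<rho> / (F \<rho>)\<^sup>2)) (at \<rho>)" for \<rho>
    using F_pos[of \<rho>] by (auto intro!: derivative_eq_intros DF simp: power2_eq_square)
  from partial_eq[OF has_derivative_radial[OF this]] True show ?thesis
    by (simp add: gram_conformal mat_def inner_axis algebra_simps)
next
  case False
  then show ?thesis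
    using partial_eq[OF has_derivative_const] by (simp add: gram_conformal mat_def)
qed

text \<open>The Christoffel symbols of exp(2u) times the flat metric, where u = - (1/2) ln F(|w|^2)
  has the partial derivatives - (F'/F) w_i.\<close>

lemma christoffel_conformal:
  "christoffel g k i j w = (F' (w \<bullet> w) / F (w \<bullet> w)) *
     ((if i = j then w $ k else 0) - (if k = i then w $ j else 0) - (if k = j then w $ i else 0))"
proof -
  let ?F = "F (w \<bullet> w)" and ?F' = "F' (w \<bullet> w)"
  have F: "?F > 0" by (rule F_pos)
  have "matrix_inv (gram g w) $ k $ l = (if k = l then ?F else 0)" for l
    using F unfolding gram_conformal by (subst matrix_inv_scaleR_mat) (simp_all add: mat_def)
  then have "christoffel g k i j w = (1/2) * (\<Sum>l\<in>UNIV. if k = l then ?F *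
     (partial i (\<lambda>w. gram g w $ j $ l) w + partial j (\<lambda>w. gram g w $ i $ l) w
       - partial l (\<lambda>w. gram g w $ i $ j) w) else 0)"
    unfolding christoffel_def by (intro arg_cong2[of _ _ _ _ "(*)"] sum.cong) auto
  also have "\<dots> = (1/2) * (?F *
     (partial i (\<lambda>w. gram g w $ j $ k) w + partial j (\<lambda>w. gram g w $ i $ k) w
       - partial k (\<lambda>w. gram g w $ i $ j) w))"
    by simp
  also have "\<dots> = (?F' / ?F) *
     ((if i = j then w $ k else 0) - (if k = i then w $ j else 0) - (if k = j then w $ i else 0))"
    using F unfolding partial_gram by (auto simp: field_simps power2_eq_square)
  finally show ?thesis .
qed

text \<open>One component on one coordinate axis is enough for the comparison of curvatures. On the
  axis all coordinates but the i-th vanish, which leaves few terms; the derivatives are still taken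
  in a full neighbourhood.\<close>

lemma riemann_radial:
  assumes "i \<noteq> j"
  shows "riemann g i i j j (t *\<^sub>R axis i 1)
     = 2 * (F' (t\<^sup>2) / F (t\<^sup>2))
       + 2 * t\<^sup>2 * ((F'' (t\<^sup>2) * F (t\<^sup>2) - (F' (t\<^sup>2))\<^sup>2) / (F (t\<^sup>2))\<^sup>2)"
proof -
  define w :: "real^'n" where "w = t *\<^sub>R axis i 1"
  have w: "w \<bullet> w = t\<^sup>2" "w $ i = t" "\<And>k. w $ k = (if k = i then t else 0)"
    by (simp_all add: w_def inner_axis_axis power2_eq_square) (simp_all add: axis_def)
  define M where "M \<rho> = F' \<rho> / F \<rho>" for \<rho>
  define M' where "M' \<rho> = (F'' \<rho> * F \<rho> - (F' \<rho>)\<^sup>2) / (F \<rho>)\<^sup>2" for \<rho>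
  have M: "(M has_real_derivative M' \<rho>) (at \<rho>)" for \<rho>
    unfolding M_def M'_def using F_pos[of \<rho>]
    by (auto intro!: derivative_eq_intros DF DF' simp: power2_eq_square)
  have D: "((\<lambda>w::real^'n. M (w \<bullet> w) * w $ k) has_derivative
      (\<lambda>v. M (w \<bullet> w) * v $ k + M' (w \<bullet> w) * (2 * (w \<bullet> v)) * w $ k)) (at w)" for k
    by (rule has_derivative_mult[OF has_derivative_radial[OF M]])
       (intro bounded_linear_imp_has_derivative bounded_linear_vec_nth)
  have 1: "partial i (christoffel g i j j) w = M (t\<^sup>2) + 2 * M' (t\<^sup>2) * t\<^sup>2"
  proof -
    have "christoffel g i j j = (\<lambda>w. M (w \<bullet> w) * w $ i)"
      using assms by (auto simp: christoffel_conformal M_def)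
    then show ?thesis
      using partial_eq[OF D[of i], of i] by (simp add: w inner_axis power2_eq_square)
  qed
  have 2: "partial j (christoffel g i i j) w = - M (t\<^sup>2)"
  proof -
    have "christoffel g i i j = (\<lambda>w. - (M (w \<bullet> w) * w $ j))"
      using assms by (auto simp: christoffel_conformal M_def)
    then show ?thesis
      using partial_eq[OF has_derivative_minus[OF D[of j]], of j] assms by (simp add: w inner_axis)
  qed
  have 3: "(\<Sum>m\<in>UNIV. christoffel g i i m w * christoffel g m j j w
                  - christoffel g i j m w * christoffel g m i j w) = 0"
  proof -
    \<comment> \<open>Only m = j and m = i contribute, with opposite signs, so the quadratic part
      cancels.\<close>
    have "christoffel g i i m w * christoffel g m j j w
        - christoffel g i j m w * christoffel g m i j w
        = (if m = j then (M (t\<^sup>2) * t)\<^sup>2 else 0) - (if m = i then (M (t\<^sup>2) * t)\<^sup>2 else 0)" for m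
      using assms by (auto simp: christoffel_conformal w M_def power2_eq_square)
    then show ?thesis by (simp add: sum_subtractf)
  qed
  show ?thesis
    unfolding riemann_def w_def[symmetric] 1 2 3 by (simp add: M_def M'_def)
qed

text \<open>The numerator carries one factor 1/F from the metric and the denominator two, so the
  curvature is F times the component from \<open>riemann_radial\<close>.\<close>

lemma sectional_curvature_radial:
  assumes "i \<noteq> j"
  shows "sectional_curvature g (t *\<^sub>R axis i 1) (axis i 1) (axis j 1)
     = 2 * F' (t\<^sup>2) + 2 * t\<^sup>2 * (F'' (t\<^sup>2) - (F' (t\<^sup>2))\<^sup>2 / F (t\<^sup>2))"
proof -
  have [simp]: "axis i 1 $ j = (0::real)" using assms by (simp add: axis_def)
  let ?w = "t *\<^sub>R axis i 1 :: real^'n"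
  have F: "F (t\<^sup>2) > 0" by (rule F_pos)
  have w: "?w \<bullet> ?w = t\<^sup>2" by (simp add: inner_axis_axis power2_eq_square)
  have "curvature_operator g ?w (axis i 1) (axis j 1) (axis j 1) $ i = riemann g i i j j ?w"
    by (simp add: curvature_operator_def axis_def if_distrib[of "\<lambda>x. _ * x"] cong: if_cong)
  then have "sectional_curvature g ?w (axis i 1) (axis j 1) = F (t\<^sup>2) * riemann g i i j j ?w"
    using F assms by (simp add: sectional_curvature_def g_def w inner_axis_axis inner_axis
        power2_eq_square field_simps)
  also have "\<dots> = 2 * F' (t\<^sup>2) + 2 * t\<^sup>2 * (F'' (t\<^sup>2) - (F' (t\<^sup>2))\<^sup>2 / F (t\<^sup>2))"
    using F unfolding riemann_radial[OF assms] by (simp add: field_simps power2_eq_square)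
  finally show ?thesis .
qed

end

section \<open>Metrics of the shape \<open>A / (\<alpha> + \<beta> s\<^sup>2) g\<^sub>0\<close>\<close>

text \<open>Inverse stereographic projection from the south pole (0, -1): the second point of the
  sphere on the line through that pole and (w, 0). The origin goes to the north pole and the unit
  sphere |w| = 1 to the equator.\<close>

definition stereographic :: "real^'n::finite \<Rightarrow> 'n real_space" where
  "stereographic w = (0, -1) + (2 * inverse (1 + w \<bullet> w)) *\<^sub>R (w, 1)"

lemma one_plus_inner_self_pos: "1 + w \<bullet> w > 0" for w :: "'a::real_inner"
  by (simp add: add_pos_nonneg)

lemma mem_unit_sphere: "(v, s) \<in> unit_sphere \<longleftrightarrow> v \<bullet> v + s\<^sup>2 = 1"
  by (auto simp: norm_eq_1 power2_eq_square)

lemma stereographic_in_sphere: "stereographic w \<in> unit_sphere"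
proof -
  define c where "c = 1 + w \<bullet> w"
  have "c > 0" "w \<bullet> w = c - 1" using one_plus_inner_self_pos[of w] by (simp_all add: c_def)
  then show ?thesis
    unfolding stereographic_def scaleR_Pair add_Pair mem_unit_sphere c_def[symmetric]
    by (simp add: field_simps power2_eq_square)
qed

lemma snd_stereographic: "snd (stereographic w) = (1 - w \<bullet> w) / (1 + w \<bullet> w)"
  using one_plus_inner_self_pos[of w] by (simp add: stereographic_def field_simps)

lemma Ck_on_stereographic: "Ck_on k UNIV stereographic"
proof -
  have lin: "bounded_linear (\<lambda>w::real^'n::finite. (w, 0::real))"
    by (intro bounded_linear_Pair bounded_linear_ident bounded_linear_zero)
  have "Ck_on k UNIV (\<lambda>w::real^'n::finite. (0, -1) + (2 * inverse (1 + w \<bullet> w)) *\<^sub>R ((w, 0) + (0, 1 :: real)))"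
    by (intro Ck_on_add Ck_on_const Ck_on_bilinear[OF bounded_bilinear_scaleR]
        Ck_on_bilinear[OF bounded_bilinear_mult] Ck_on_inverse Ck_on_linear[OF lin]
        Ck_on_bilinear[OF bounded_bilinear_inner] Ck_on_linear[OF bounded_linear_ident] open_UNIV
        one_plus_inner_self_pos[THEN less_imp_neq, THEN not_sym])
  then show ?thesis by (simp add: stereographic_def[abs_def])
qed

definition stereographic_inverse :: "'n::finite real_space \<Rightarrow> real^'n" where
  "stereographic_inverse p = inverse (1 + snd p) *\<^sub>R fst p"

text \<open>The open half-space is an ambient neighbourhood of the image of the chart, so this
  formula is the smooth extension that \<open>smooth_on\<close> asks of the inverse chart.\<close>

lemma Ck_on_stereographic_inverse: "Ck_on k {p. snd p > -1} stereographic_inverse"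
proof -
  have op: "open {p :: 'n::finite real_space. snd p > -1}"
    by (intro open_Collect_less continuous_intros)
  show ?thesis unfolding stereographic_inverse_def[abs_def]
    by (intro Ck_on_bilinear[OF bounded_bilinear_scaleR] Ck_on_inverse op Ck_on_add Ck_on_const
        Ck_on_linear bounded_linear_fst bounded_linear_snd) auto
qed

lemma stereographic_inverse_left: "stereographic_inverse (stereographic w) = w"
  using one_plus_inner_self_pos[of w]
  by (simp add: stereographic_inverse_def stereographic_def)

text \<open>On the sphere the last coordinate is -1 only at the south pole, so the image is the
  sphere without that pole; written with an open half-space, its relative openness is
  immediate.\<close>

lemma range_stereographic: "range stereographic = unit_sphere \<inter> {p. snd p > -1}"
proof (intro set_eqI iffI)
  fix p assume "p \<in> range stereographic"
  then obtain w where w: "p = stereographic w" by auto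
  have "snd p + 1 = 2 * inverse (1 + w \<bullet> w)" by (simp add: w stereographic_def)
  moreover have "2 * inverse (1 + w \<bullet> w) > 0" using one_plus_inner_self_pos[of w] by simp
  ultimately have "snd p > -1" by linarith
  moreover have "p \<in> unit_sphere" unfolding w by (rule stereographic_in_sphere)
  ultimately show "p \<in> unit_sphere \<inter> {p. snd p > -1}" by simp
next
  fix p assume "p \<in> unit_sphere \<inter> {p. snd p > -1}"
  then obtain v s where p: "p = (v, s)" "s > -1" "v \<bullet> v + s\<^sup>2 = 1"
    using mem_unit_sphere[of "fst p" "snd p"] that[of "fst p" "snd p"] by simp
  \<comment> \<open>The preimage will be w = v / (1 + s); this factorisation gives 1 + |w|^2 = 2 /
    (1 + s).\<close>
  have s: "1 + s > 0" "v \<bullet> v = (1 + s) * (1 - s)"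
    using p by (simp_all add: power2_eq_square algebra_simps)
  have "1 + (inverse (1 + s) *\<^sub>R v) \<bullet> (inverse (1 + s) *\<^sub>R v) = 2 / (1 + s)"
    using s(1) unfolding inner_scaleR_left inner_scaleR_right s(2)
    by (simp add: divide_simps)
  then have "2 * inverse (1 + (inverse (1 + s) *\<^sub>R v) \<bullet> (inverse (1 + s) *\<^sub>R v)) = 1 + s"
    by simp
  then have "stereographic (inverse (1 + s) *\<^sub>R v) = p"
    unfolding stereographic_def using s(1) by (simp only: scaleR_Pair) (simp add: p(1))
  then show "p \<in> range stereographic" by blast
qed

lemma local_parametrization_stereographic: "local_parametrization UNIV (stereographic :: real^'n::finite \<Rightarrow> _)"
  unfolding local_parametrization_def diffeomorphism_on_def
proof (intro conjI)
  have op: "open {p :: 'n::finite real_space. snd p > -1}"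
    by (intro open_Collect_less continuous_intros)
  then show "openin (top_of_set unit_sphere) (range stereographic :: 'n::finite real_space set)"
    unfolding range_stereographic by (rule openin_open_Int)
  have inj: "inj (stereographic :: real^'n::finite \<Rightarrow> _)"
    by (rule inj_on_inverseI) (rule stereographic_inverse_left)
  then show "bij_betw (stereographic :: real^'n::finite \<Rightarrow> _) UNIV (range stereographic)"
    by (rule inj_on_imp_bij_betw)
  show "smooth_on UNIV (stereographic :: real^'n::finite \<Rightarrow> _)"
    by (rule smooth_onI[OF open_UNIV _ Ck_on_stereographic]) auto
  show "smooth_on (range stereographic) (inv (stereographic :: real^'n::finite \<Rightarrow> _))"
    by (rule smooth_onI[OF op _ Ck_on_stereographic_inverse])
       (simp add: range_stereographic, auto simp: stereographic_inverse_left inv_f_f[OF inj])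
qed simp

lemma has_derivative_stereographic:
  "(stereographic has_derivative
     (\<lambda>V. (2 / (1 + w \<bullet> w)) *\<^sub>R (V, 0) - (4 * (w \<bullet> V) / (1 + w \<bullet> w)\<^sup>2) *\<^sub>R (w, 1))) (at w)"
proof -
  have c: "1 + w \<bullet> w \<noteq> 0" using one_plus_inner_self_pos[of w] by simp
  have "((\<lambda>w. 1 + w \<bullet> w) has_derivative (\<lambda>V. 0 + (w \<bullet> V + V \<bullet> w))) (at w)"
    by (intro has_derivative_add has_derivative_const has_derivative_inner has_derivative_ident)
  from Deriv.has_derivative_inverse[OF c this]
  have "((\<lambda>w. 2 * inverse (1 + w \<bullet> w)) has_derivative (\<lambda>V. - (4 * (w \<bullet> V) / (1 + w \<bullet> w)\<^sup>2))) (at w)"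
    by (intro has_derivative_eq_rhs[OF has_derivative_mult_right])
       (auto simp: fun_eq_iff inner_commute divide_inverse power2_eq_square mult_ac)
  from has_derivative_add[OF has_derivative_const[of "(0, -1)"] has_derivative_scaleR[OF this
        has_derivative_Pair[OF has_derivative_ident has_derivative_const[of "1::real"]]]]
  show ?thesis
    by (simp add: stereographic_def[abs_def] divide_inverse)
qed

text \<open>The chart is conformal with factor 4 / (1 + |w|^2)^2, and the height is s = (1 - |w|^2)
  / (1 + |w|^2). Clearing denominators gives the quotient by F from the opening remarks.\<close>

lemma pullback_stereographic:
  assumes "\<And>p X Y. p \<in> unit_sphere \<Longrightarrow> X \<in> tangent_space unit_sphere p \<Longrightarrow>
      Y \<in> tangent_space unit_sphere p \<Longrightarrow> G p X Y = A / (\<alpha> + \<beta> * (snd p)\<^sup>2) * (X \<bullet> Y)"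
    and "A > 0" "\<alpha> > 0" "\<beta> > 0"
  shows "pullback UNIV stereographic G w X Y
     = (X \<bullet> Y) / ((\<alpha> * (1 + w \<bullet> w)\<^sup>2 + \<beta> * (1 - w \<bullet> w)\<^sup>2) / (4 * A))"
proof -
  define c where "c = 1 + w \<bullet> w"
  have c: "c > 0" "w \<bullet> w = c - 1" using one_plus_inner_self_pos[of w] by (simp_all add: c_def)
  define D where "D V = (2 / c) *\<^sub>R (V, 0) - (4 * (w \<bullet> V) / c\<^sup>2) *\<^sub>R (w, 1::real)" for V
  have hD: "(stereographic has_derivative D) (at w)"
    using has_derivative_stereographic[of w] by (simp add: D_def[abs_def] c_def)
  \<comment> \<open>The formula for \<open>G\<close> is assumed on tangent vectors only.\<close>
  have "D V \<in> tangent_space unit_sphere (stereographic w)" for V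
    using stereographic_in_sphere tangent_space_image[OF hD tangent_space_UNIV] by blast
  then have "pullback UNIV stereographic G w X Y
      = A / (\<alpha> + \<beta> * ((1 - w \<bullet> w) / c)\<^sup>2) * (D X \<bullet> D Y)"
    unfolding pullback_def differential_eq[OF hD tangent_space_UNIV]
    by (subst assms(1)[OF stereographic_in_sphere]) (simp_all add: snd_stereographic c_def)
  \<comment> \<open>The products (w \<bullet> X) (w \<bullet> Y) cancel because (w, 1) has squared
    length c.\<close>
  also have "D X \<bullet> D Y = 4 / c\<^sup>2 * (X \<bullet> Y)"
    using c(1) by (simp add: D_def inner_diff_left inner_diff_right c(2) inner_commute
        power2_eq_square field_simps)
  also have "A / (\<alpha> + \<beta> * ((1 - w \<bullet> w) / c)\<^sup>2) * (4 / c\<^sup>2 * (X \<bullet> Y))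
      = (X \<bullet> Y) / ((\<alpha> * c\<^sup>2 + \<beta> * (1 - w \<bullet> w)\<^sup>2) / (4 * A))"
  proof -
    have "\<alpha> * c\<^sup>2 + \<beta> * (1 - w \<bullet> w)\<^sup>2 > 0" using c(1) assms by (simp add: add_pos_nonneg)
    moreover have "\<alpha> + \<beta> * ((1 - w \<bullet> w) / c)\<^sup>2 = (\<alpha> * c\<^sup>2 + \<beta> * (1 - w \<bullet> w)\<^sup>2) / c\<^sup>2"
      using c(1) by (simp add: field_simps)
    ultimately show ?thesis using c(1) assms(2) by simp
  qed
  finally show ?thesis by (simp add: c_def)
qed

lemma not_constant_sectional_curvature:
  fixes G :: "'n::finite real_space metric_tensor"
  assumes "\<And>p X Y. p \<in> unit_sphere \<Longrightarrow> X \<in> tangent_space unit_sphere p \<Longrightarrow>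
      Y \<in> tangent_space unit_sphere p \<Longrightarrow> G p X Y = A / (\<alpha> + \<beta> * (snd p)\<^sup>2) * (X \<bullet> Y)"
    and "A > 0" "\<alpha> > 0" "\<beta> > 0" and card: "CARD('n) \<ge> 2"
  shows "\<not> constant_sectional_curvature G"
proof
  define F where "F \<rho> = (\<alpha> * (1 + \<rho>)\<^sup>2 + \<beta> * (1 - \<rho>)\<^sup>2) / (4 * A)" for \<rho>
  define F' where "F' \<rho> = (2 * \<alpha> * (1 + \<rho>) - 2 * \<beta> * (1 - \<rho>)) / (4 * A)" for \<rho>
  define F'' where "F'' \<rho> = (2 * \<alpha> + 2 * \<beta>) / (4 * A)" for \<rho> :: real
  let ?g = "pullback UNIV stereographic G"
  have "F \<rho> > 0" for \<rho>
  \<comment> \<open>The two squares in F have no common zero: at 1 the \<alpha> term is positive,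
    elsewhere the \<beta> term is.\<close>
  proof (cases "\<rho> = 1")
    case True
    then show ?thesis using assms by (simp add: F_def)
  next
    case False
    then show ?thesis using assms by (simp add: F_def add_nonneg_pos)
  qed
  moreover have "(F has_real_derivative F' \<rho>) (at \<rho>)" for \<rho>
    unfolding F_def F'_def using \<open>A > 0\<close>
    by (auto intro!: derivative_eq_intros simp: field_simps)
  moreover have "(F' has_real_derivative F'' \<rho>) (at \<rho>)" for \<rho>
    unfolding F'_def F''_def using \<open>A > 0\<close>
    by (auto intro!: derivative_eq_intros simp: field_simps)
  moreover have "?g = (\<lambda>w X Y. (X \<bullet> Y) / F (w \<bullet> w))"
    using pullback_stereographic[OF assms(1-4)] by (simp add: fun_eq_iff F_def)
  ultimately have curv: "i \<noteq> j \<Longrightarrow> sectional_curvature ?g (t *\<^sub>R axis i 1) (axis i 1) (axis j 1)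
      = 2 * F' (t\<^sup>2) + 2 * t\<^sup>2 * (F'' (t\<^sup>2) - (F' (t\<^sup>2))\<^sup>2 / F (t\<^sup>2))" for i j t
    by (rule sectional_curvature_radial)
  obtain i j :: 'n where ij: "i \<noteq> j"
  proof -
    have "\<not> card (UNIV :: 'n set) \<le> Suc 0" using card by simp
    then show thesis using that by (auto simp: card_le_Suc0_iff_eq)
  qed
  have "axis i 1 \<noteq> (axis j 1 :: real^'n)" using ij by (simp add: axis_eq_axis)
  moreover have "independent {axis i 1, axis j 1 :: real^'n}"
    by (rule independent_mono[OF independent_Basis]) (auto simp: axis_in_Basis_iff)
  moreover assume "constant_sectional_curvature G"
  then obtain \<kappa> where \<kappa>: "\<forall>U \<phi>. local_parametrization U \<phi> \<longrightarrow> (\<forall>w\<in>U. \<forall>X Y. X \<noteq> Y \<and> independent {X, Y} \<longrightarrow>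
      sectional_curvature (pullback U \<phi> G) w X Y = \<kappa>)"
    unfolding constant_sectional_curvature_def by (rule exE)
  ultimately have K: "sectional_curvature ?g w (axis i 1) (axis j 1) = \<kappa>" for w
    using \<kappa>[rule_format, OF local_parametrization_stereographic UNIV_I] by simp
  \<comment> \<open>The parameter t = 0 is the north pole.\<close>
  have "\<kappa> = 2 * F' 0"
    using K[of "0 *\<^sub>R axis i 1"] unfolding curv[OF ij] by simp
  also have "\<dots> = (\<alpha> - \<beta>) / A"
    using \<open>A > 0\<close> by (simp add: F'_def field_simps)
  finally have 0: "\<kappa> = (\<alpha> - \<beta>) / A" .
  \<comment> \<open>The parameter t = 1 lies on the equator. Since F and F' coincide there, F'
    cancels against F'^2 / F and the curvature is 2 F''.\<close>
  have F1: "F 1 = \<alpha> / A" "F' 1 = \<alpha> / A"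
    using \<open>A > 0\<close> by (simp_all add: F_def F'_def)
  have "\<kappa> = 2 * F' 1 + 2 * (F'' 1 - (F' 1)\<^sup>2 / F 1)"
    using K[of "1 *\<^sub>R axis i 1"] unfolding curv[OF ij] by simp
  also have "\<dots> = 2 * F'' 1"
    using assms(2,3) by (simp add: F1 power2_eq_square)
  also have "\<dots> = (\<alpha> + \<beta>) / A"
    using \<open>A > 0\<close> by (simp add: F''_def field_simps)
  finally have "\<alpha> - \<beta> = \<alpha> + \<beta>"
    using \<open>A > 0\<close> by (simp add: 0)
  then show False using assms(4) by simp
qed

lemma conformally_equivalent:
  fixes G :: "'n::finite real_space metric_tensor"
  assumes G: "\<And>p X Y. p \<in> unit_sphere \<Longrightarrow> X \<in> tangent_space unit_sphere p \<Longrightarrow>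
      Y \<in> tangent_space unit_sphere p \<Longrightarrow> G p X Y = A / (\<alpha> + \<beta> * (snd p)\<^sup>2) * (X \<bullet> Y)"
    and pos: "A > 0" "\<alpha> > 0" "\<beta> > 0"
  shows "conformally_equivalent_to_round G"
  unfolding conformally_equivalent_to_round_def
proof (intro exI conjI ballI)
  \<comment> \<open>The conformal factor, extended to the whole ambient space; the function f is
    half its logarithm.\<close>
  define h where "h p = A * inverse (\<alpha> + \<beta> * (snd p * snd p))" for p :: "'n real_space"
  have den: "\<alpha> + \<beta> * (snd p * snd p) > 0" for p :: "'n real_space"
    using pos by (simp add: add_pos_nonneg)
  then have h: "h p > 0" for p using pos by (simp add: h_def)
  let ?f = "\<lambda>p. inverse 2 * ln (h p)"
  have "smooth_on unit_sphere (inv_into unit_sphere (id :: 'n::finite real_space \<Rightarrow> _))"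
    by (rule smooth_onI[of UNIV _ "\<lambda>x. x"])
       (simp_all add: Ck_on_linear[OF bounded_linear_ident] inv_into_f_f[of id, simplified])
  then show "diffeomorphism_on unit_sphere unit_sphere (id :: 'n::finite real_space \<Rightarrow> _)"
    by (simp add: diffeomorphism_on_def smooth_on_id)
  have "Ck_on k UNIV h" for k
    unfolding h_def
    by (intro Ck_on_bilinear[OF bounded_bilinear_mult] Ck_on_const Ck_on_inverse Ck_on_add
        Ck_on_linear bounded_linear_snd open_UNIV den[THEN less_imp_neq, THEN not_sym])
  then show "smooth_on unit_sphere ?f"
    by (intro smooth_onI[OF open_UNIV subset_UNIV, of ?f] Ck_on_bilinear[OF bounded_bilinear_mult]
        Ck_on_const Ck_on_ln open_UNIV h refl)
  fix p X Y :: "'n real_space"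
  assume p: "p \<in> unit_sphere"
    and XY: "X \<in> tangent_space unit_sphere p" "Y \<in> tangent_space unit_sphere p"
  have "(id has_derivative (\<lambda>X. X)) (at p within unit_sphere)"
    by (simp add: id_def)
  then have "pullback unit_sphere id G p X Y = G p X Y"
    using XY by (simp add: pullback_def differential_eq)
  also have "\<dots> = h p * (X \<bullet> Y)"
    using G[OF p XY] by (simp add: h_def divide_inverse power2_eq_square)
  also have "h p = exp (2 * ?f p)"
    using h[of p] by simp
  finally show "pullback unit_sphere id G p X Y = exp (2 * ?f p) * (X \<bullet> Y)" .
qed

section \<open>The induced metrics\<close>

text \<open>Common reduction of the three cases: what remains is a computation in coordinates, where
  unit length and tangency enter through v \<bullet> v, v \<bullet> V and v \<bullet> W.\<close>

lemma whitney_metric_conclusion: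
  fixes G :: "'n::finite real_space metric_tensor"
  assumes "\<And>v s V \<sigma> W \<tau>. v \<bullet> v = 1 - s\<^sup>2 \<Longrightarrow> v \<bullet> V = - (s * \<sigma>) \<Longrightarrow> v \<bullet> W = - (s * \<tau>) \<Longrightarrow>
      (v, s) \<in> unit_sphere \<Longrightarrow>
      (V, \<sigma>) \<in> tangent_space unit_sphere (v, s) \<Longrightarrow> (W, \<tau>) \<in> tangent_space unit_sphere (v, s) \<Longrightarrow>
      G (v, s) (V, \<sigma>) (W, \<tau>) = A / (\<alpha> + \<beta> * s\<^sup>2) * (V \<bullet> W + \<sigma> * \<tau>)"
    and "A > 0" "\<alpha> > 0" "\<beta> > 0" "CARD('n) \<ge> 2"
  shows "\<not> constant_sectional_curvature G \<and> conformally_equivalent_to_round G"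
proof -
  have "G p X Y = A / (\<alpha> + \<beta> * (snd p)\<^sup>2) * (X \<bullet> Y)"
    if p: "p \<in> unit_sphere" and X: "X \<in> tangent_space unit_sphere p"
      and Y: "Y \<in> tangent_space unit_sphere p" for p X Y
  proof -
    obtain v s V \<sigma> W \<tau> where eqs: "p = (v, s)" "X = (V, \<sigma>)" "Y = (W, \<tau>)"
      by (cases p, cases X, cases Y)
    show ?thesis
      using assms(1)[of v s V \<sigma> W \<tau>] p X Y tangent_space_sphere[OF X] tangent_space_sphere[OF Y]
        mem_unit_sphere[of v s] unfolding eqs by (simp add: algebra_simps del: mem_sphere_0)
  qed
  then show ?thesis
    using not_constant_sectional_curvature conformally_equivalent assms(2-) by blast
qed

section \<open>Derivatives of maps assembled from v and functions of s\<close>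

lemma has_derivative_snd_compose:
  assumes "(f has_vector_derivative f') (at s)"
  shows "((\<lambda>u. f (snd u)) has_derivative (\<lambda>X. snd X *\<^sub>R f')) (at (v, s) within S)"
proof -
  have "(f has_derivative (\<lambda>x. x *\<^sub>R f')) (at (snd (v, s)) within snd ` S)"
    using has_derivative_at_withinI[OF assms[unfolded has_vector_derivative_def]] by simp
  from diff_chain_within[OF bounded_linear_imp_has_derivative[OF bounded_linear_snd] this]
  show ?thesis by (simp add: o_def)
qed

lemma has_derivative_fst_snd:
  assumes "bounded_bilinear B" "(f has_vector_derivative f') (at s)"
  shows "((\<lambda>u. B (fst u) (f (snd u))) has_derivative
    (\<lambda>X. B v (snd X *\<^sub>R f') + B (fst X) (f s))) (at (v, s) within S)"
  using bounded_bilinear.FDERIV[OF assms(1)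
      bounded_linear_imp_has_derivative[OF bounded_linear_fst]
      has_derivative_snd_compose[OF assms(2), of v S]]
  by simp

subsection \<open>The flat model\<close>

lemma has_derivative_flat_whitney:
  "(flat_whitney B b r has_derivative (\<lambda>(V, \<sigma>).
      ((r * s / (1 + s\<^sup>2)) *\<^sub>R V + (\<sigma> * (r * (1 - s\<^sup>2) / (1 + s\<^sup>2)\<^sup>2)) *\<^sub>R v,
       (r / (1 + s\<^sup>2)) *\<^sub>R V + (\<sigma> * (- (2 * r * s) / (1 + s\<^sup>2)\<^sup>2)) *\<^sub>R v,
       \<sigma> * (r\<^sup>2 * (1 - 3 * s\<^sup>2) / (1 + s\<^sup>2) ^ 3)))) (at (v, s) within S)"
proof -
  have pos: "1 + t\<^sup>2 > 0" for t :: real by (simp add: add_pos_nonneg)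
  then have nz: "1 + t\<^sup>2 \<noteq> 0" for t :: real by (metis less_irrefl)
  have 1: "((\<lambda>s. r * s / (1 + s\<^sup>2)) has_vector_derivative r * (1 - s\<^sup>2) / (1 + s\<^sup>2)\<^sup>2) (at s)"
    unfolding has_real_derivative_iff_has_vector_derivative[symmetric] using nz[of s]
    by (auto intro!: derivative_eq_intros simp: divide_simps) (simp add: algebra_simps power2_eq_square)
  have 2: "((\<lambda>s. r / (1 + s\<^sup>2)) has_vector_derivative - (2 * r * s) / (1 + s\<^sup>2)\<^sup>2) (at s)"
    unfolding has_real_derivative_iff_has_vector_derivative[symmetric] using nz[of s]
    by (auto intro!: derivative_eq_intros simp: divide_simps) (simp add: algebra_simps power2_eq_square)
  have 3: "((\<lambda>s. r\<^sup>2 * s / (1 + s\<^sup>2)\<^sup>2 + r * b) has_vector_derivative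
      r\<^sup>2 * (1 - 3 * s\<^sup>2) / (1 + s\<^sup>2) ^ 3) (at s)"
    unfolding has_real_derivative_iff_has_vector_derivative[symmetric] using nz[of s]
    by (intro DERIV_cong[OF DERIV_add[OF _ DERIV_const]], auto intro!: derivative_eq_intros)
       (auto simp: divide_simps, simp add: algebra_simps eval_nat_numeral)
  \<comment> \<open>The parameter b only adds the constant r b to the last coordinate, so it
    disappears from the derivative.\<close>
  have z: "r * (r * t / (1 + t\<^sup>2) + b * (1 + t\<^sup>2)) / (1 + t\<^sup>2) = r\<^sup>2 * t / (1 + t\<^sup>2)\<^sup>2 + r * b" for t
    using nz[of t] by (simp add: divide_simps) (simp add: algebra_simps eval_nat_numeral)
  have eq: "flat_whitney B b r = (\<lambda>u. ((r * snd u / (1 + (snd u)\<^sup>2)) *\<^sub>R fst u,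
      (r / (1 + (snd u)\<^sup>2)) *\<^sub>R fst u, r\<^sup>2 * snd u / (1 + (snd u)\<^sup>2)\<^sup>2 + r * b) + B)"
    by (simp add: fun_eq_iff flat_whitney_def z)
  note bilin = bounded_bilinear.flip[OF bounded_bilinear_scaleR]
  show ?thesis unfolding eq
    by (rule has_derivative_eq_rhs[OF has_derivative_add[OF has_derivative_Pair[OF
          has_derivative_fst_snd[OF bilin 1] has_derivative_Pair[OF has_derivative_fst_snd[OF bilin 2]
          has_derivative_snd_compose[OF 3]]] has_derivative_const]])
       (auto simp: fun_eq_iff)
qed

lemma flat_whitney_conclusion:
  fixes x :: "'n::finite real_space \<Rightarrow> 'n flat_space"
  assumes "flat_contact_whitney_sphere x" "CARD('n) \<ge> 2"
  shows "\<not> constant_sectional_curvature (pullback unit_sphere x (metric flat_model)) \<and>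
    conformally_equivalent_to_round (pullback unit_sphere x (metric flat_model))"
proof -
  obtain r b B where r: "r > 0" and B: "fst (snd B) = 0"
    and cong: "congruent_on_sphere flat_model (flat_whitney B b r) x"
    using assms(1) by (auto simp: flat_contact_whitney_sphere_def)
  show ?thesis
  proof (rule whitney_metric_conclusion[of _ "r\<^sup>2 / 4" 1 1])
    fix v V W :: "real^'n" and s \<sigma> \<tau> :: real
    assume v: "v \<bullet> v = 1 - s\<^sup>2" "v \<bullet> V = - (s * \<sigma>)" "v \<bullet> W = - (s * \<tau>)"
      and p: "(v, s) \<in> unit_sphere" and X: "(V, \<sigma>) \<in> tangent_space unit_sphere (v, s)"
      and Y: "(W, \<tau>) \<in> tangent_space unit_sphere (v, s)"
    define c where "c = 1 + s\<^sup>2"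
    have c: "c > 0" by (simp add: c_def add_pos_nonneg)
    have s: "s\<^sup>2 = c - 1" by (simp add: c_def)
    define f g f' g' where "f = r * s / c" and "g = r / c" and "f' = r * (2 - c) / c\<^sup>2"
      and "g' = - (2 * r * s) / c\<^sup>2"
    define D where "D = (\<lambda>(V :: real^'n, \<sigma>). (f *\<^sub>R V + (\<sigma> * f') *\<^sub>R v, g *\<^sub>R V + (\<sigma> * g') *\<^sub>R v,
       \<sigma> * (r\<^sup>2 * (1 - 3 * s\<^sup>2) / c ^ 3)))"
    have hD: "(flat_whitney B b r has_derivative D) (at (v, s) within unit_sphere)"
      using has_derivative_flat_whitney[of B b r s v]
      by (simp add: D_def f_def g_def f'_def g'_def c_def)
    \<comment> \<open>The Legendrian condition: it removes the contact form from the metric and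
      leaves a quarter of the Euclidean product of the x and y parts. The vanishing y part of
      \<open>B\<close> keeps the y coordinate equal to \<open>g *\<^sub>R v\<close>.\<close>
    have eta: "flat_eta (flat_whitney B b r (v, s)) (D (U, \<rho>)) = 0" if "v \<bullet> U = - (s * \<rho>)" for U \<rho>
    proof -
      have "fst (snd (flat_whitney B b r (v, s))) = g *\<^sub>R v"
        using B by (simp add: flat_whitney_def g_def c_def)
      then have "flat_eta (flat_whitney B b r (v, s)) (D (U, \<rho>))
          = (1/2) * (\<rho> * (r\<^sup>2 * (1 - 3 * s\<^sup>2) / c ^ 3) - g * (f * (- (s * \<rho>)) + \<rho> * f' * (1 - s\<^sup>2)))"
        by (simp add: flat_eta_def D_def case_prod_beta inner_add_right that v(1) algebra_simps
            add_divide_distrib diff_divide_distrib)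
      also have "\<dots> = (1/2) * \<rho> * (r\<^sup>2 * (1 - 3 * s\<^sup>2) / c ^ 3 + g * f * s - g * f' * (1 - s\<^sup>2))"
        by (simp add: algebra_simps)
      also have "g * f * s = r\<^sup>2 * s\<^sup>2 / c\<^sup>2"
        by (simp add: f_def g_def power2_eq_square)
      also have "g * f' = r\<^sup>2 * (2 - c) / c ^ 3"
        by (simp add: f'_def g_def power2_eq_square power3_eq_cube)
      also have "r\<^sup>2 * (1 - 3 * s\<^sup>2) / c ^ 3 + r\<^sup>2 * s\<^sup>2 / c\<^sup>2 - r\<^sup>2 * (2 - c) / c ^ 3 * (1 - s\<^sup>2) = 0"
        using c unfolding s by (simp add: divide_simps) (simp add: algebra_simps eval_nat_numeral)
      finally show ?thesis by simp
    qed
    have "pullback unit_sphere x (metric flat_model) (v, s) (V, \<sigma>) (W, \<tau>)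
        = metric flat_model (flat_whitney B b r (v, s)) (D (V, \<sigma>)) (D (W, \<tau>))"
      by (rule metric_pullback_congruent[OF cong _ hD p X Y]) (simp add: flat_model_def)
    also have "\<dots> = (1/4) * ((f\<^sup>2 + g\<^sup>2) * (V \<bullet> W)
        + \<sigma> * \<tau> * ((1 - s\<^sup>2) * (f'\<^sup>2 + g'\<^sup>2) - 2 * s * (f * f' + g * g')))"
      using eta[OF v(2)] eta[OF v(3)]
      by (simp add: flat_model_def D_def inner_add_left inner_add_right v inner_commute[of V v]
          algebra_simps power2_eq_square add_divide_distrib diff_divide_distrib)
    also have "f\<^sup>2 + g\<^sup>2 = r\<^sup>2 / c"
      using c by (simp add: f_def g_def power_mult_distrib power_divide s divide_simps)
        (simp add: algebra_simps eval_nat_numeral)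
    \<comment> \<open>Conformality: the coefficient of \<sigma> \<tau> equals that of V \<bullet>
      W.\<close>
    also have "(1 - s\<^sup>2) * (f'\<^sup>2 + g'\<^sup>2) - 2 * s * (f * f' + g * g') = r\<^sup>2 / c"
    proof -
      have "f'\<^sup>2 + g'\<^sup>2 = r\<^sup>2 / c\<^sup>2"
        using c by (simp add: f'_def g'_def power_mult_distrib power_divide s divide_simps)
          (simp add: algebra_simps eval_nat_numeral)
      moreover have "s * (f * f' + g * g') = - (r\<^sup>2 * s\<^sup>2 / c\<^sup>2)"
        using c by (simp add: f_def g_def f'_def g'_def divide_simps)
          (simp add: algebra_simps eval_nat_numeral)
      ultimately have "(1 - s\<^sup>2) * (f'\<^sup>2 + g'\<^sup>2) - 2 * (s * (f * f' + g * g'))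
          = (1 - s\<^sup>2) * (r\<^sup>2 / c\<^sup>2) - 2 * (- (r\<^sup>2 * s\<^sup>2 / c\<^sup>2))"
        by simp
      also have "\<dots> = r\<^sup>2 / c"
        using c unfolding s by (simp add: divide_simps) (simp add: algebra_simps eval_nat_numeral)
      finally show ?thesis by (simp add: mult.assoc)
    qed
    finally show "pullback unit_sphere x (metric flat_model) (v, s) (V, \<sigma>) (W, \<tau>)
        = r\<^sup>2 / 4 / (1 + 1 * s\<^sup>2) * (V \<bullet> W + \<sigma> * \<tau>)"
      by (simp add: c_def algebra_simps add_divide_distrib)
  qed (use r assms(2) in simp_all)
qed

subsection \<open>The spherical model\<close>

text \<open>The tensor of v and c under the identification of the real tensor product of R^n and C
  with C^n; inner products then factor.\<close>

definition real_tensor :: "real^'n::finite \<Rightarrow> complex \<Rightarrow> complex^'n" where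
  "real_tensor v c = (\<chi> i. (v $ i) *\<^sub>R c)"

lemma bounded_bilinear_real_tensor: "bounded_bilinear real_tensor"
  unfolding bilinear_conv_bounded_bilinear[symmetric] bilinear_def
  by (auto intro!: linearI simp: real_tensor_def vec_eq_iff algebra_simps)

lemma inner_real_tensor: "real_tensor v c \<bullet> real_tensor w d = (v \<bullet> w) * (c \<bullet> d)"
  unfolding inner_vec_def sum_distrib_right by (intro sum.cong) (auto simp: real_tensor_def)

text \<open>Writing \<open>e = cosh \<theta> + \<i> sinh \<theta> s\<close>, the last coordinate of the spherical Whitney map is
  \<open>(sinh \<theta> + \<i> cosh \<theta> s) / e\<close> and that of the hyperbolic one is \<open>e / (sinh \<theta> + \<i> cosh \<theta> s)\<close>. Hence
  the Hopf projection of the latter is \<open>v / e\<close>, and the same factor \<open>1 / e\<close> governs both cases.\<close>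

definition whitney_factor :: "real \<Rightarrow> real \<Rightarrow> real \<Rightarrow> complex" where
  "whitney_factor C S s = inverse (Complex C (S * s))"

lemma Re_Im_whitney_factor:
  "Re (whitney_factor C S s) = C / (C\<^sup>2 + S\<^sup>2 * s\<^sup>2)"
  "Im (whitney_factor C S s) = - (S * s / (C\<^sup>2 + S\<^sup>2 * s\<^sup>2))"
  by (simp_all add: whitney_factor_def power_mult_distrib)

lemma has_vector_derivative_whitney_factor:
  assumes "C \<noteq> 0"
  shows "(whitney_factor C S has_vector_derivative - (\<i> * S * (whitney_factor C S s)\<^sup>2)) (at s)"
proof -
  have "((\<lambda>s. of_real C + of_real s * (\<i> * of_real S)) has_derivative
      (\<lambda>x. 0 + of_real x * (\<i> * of_real S))) (at s)"
    by (intro has_derivative_add has_derivative_const has_derivative_mult_left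
        has_derivative_of_real has_derivative_ident)
  moreover have *: "of_real C + of_real t * (\<i> * of_real S) = Complex C (S * t)" for t
    by (simp add: complex_eq_iff)
  moreover have "Complex C (S * s) \<noteq> 0" using assms by (simp add: complex_eq_iff)
  ultimately have "((\<lambda>s. inverse (Complex C (S * s))) has_derivative
      (\<lambda>x. - (inverse (Complex C (S * s)) * (0 + of_real x * (\<i> * of_real S))
        * inverse (Complex C (S * s))))) (at s)"
    by (intro Deriv.has_derivative_inverse) simp_all
  then show ?thesis
    unfolding has_vector_derivative_def whitney_factor_def[abs_def]
    by (rule has_derivative_eq_rhs)
       (simp add: fun_eq_iff scaleR_conv_of_real power2_eq_square mult_ac)
qed

text \<open>Multiplying (sinh \<theta> + i cosh \<theta> s) / e by the conjugate of e over itself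
  recovers the original quotient, with imaginary part (cosh^2 - sinh^2) s = s.\<close>

lemma sphere_whitney_eq:
  fixes \<theta>
  defines "h \<equiv> whitney_factor (cosh \<theta>) (sinh \<theta>)"
  shows "sphere_whitney \<theta> = (\<lambda>u. (real_tensor (fst u) (h (snd u)),
    Complex (sinh \<theta>) (cosh \<theta> * snd u) * h (snd u)))"
proof -
  have h: "h s = inverse (of_real (cosh \<theta>) + \<i> * of_real (sinh \<theta> * s))" for s
    by (simp add: h_def whitney_factor_def Complex_eq)
  have ch: "(cosh \<theta>)\<^sup>2 = 1 + (sinh \<theta>)\<^sup>2" by (simp add: cosh_square_eq)
  have "(of_real (sinh \<theta> * cosh \<theta> * (1 + s\<^sup>2)) + \<i> * of_real s) / of_real ((cosh \<theta>)\<^sup>2 + (sinh \<theta>)\<^sup>2 * s\<^sup>2)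
      = Complex (sinh \<theta>) (cosh \<theta> * s) * h s" for s
    by (simp add: complex_eq_iff Re_Im_whitney_factor h_def Re_divide_of_real Im_divide_of_real
          add_divide_distrib[symmetric] diff_divide_distrib[symmetric] del: of_real_mult of_real_add of_real_power)
       (simp add: algebra_simps power2_eq_square ch[unfolded power2_eq_square])
  then show ?thesis
    by (simp add: fun_eq_iff sphere_whitney_def real_tensor_def vec_eq_iff h
        scaleR_conv_of_real divide_inverse del: of_real_mult)
qed

text \<open>Multiplication by h scales lengths by |h|, so everything reduces to |h|^2 = 1/D and the
  real and imaginary parts of h. Up to sign, i S h^2 is the derivative of h.\<close>

lemma whitney_factor_inner:
  fixes C S s :: real
  assumes "C > 0"
  defines "D \<equiv> C\<^sup>2 + S\<^sup>2 * s\<^sup>2" and "h \<equiv> whitney_factor C S s"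
  shows "h \<bullet> h = 1 / D"
    and "h\<^sup>2 \<bullet> h\<^sup>2 = 1 / D\<^sup>2"
    and "h \<bullet> (\<i> * S * h\<^sup>2) = S\<^sup>2 * s / D\<^sup>2"
    and "(\<i> * S * h\<^sup>2) \<bullet> (\<i> * S * h\<^sup>2) = S\<^sup>2 / D\<^sup>2"
    and "(\<i> * S * h\<^sup>2) \<bullet> (\<i> * h) = S * C / D\<^sup>2"
proof -
  have D: "D > 0" using assms(1) by (simp add: D_def add_pos_nonneg)
  have n: "h \<bullet> h = (cmod (h))\<^sup>2" by (simp add: dot_square_norm)
  show 1: "h \<bullet> h = 1 / D"
    using D by (simp add: inner_complex_def Re_Im_whitney_factor h_def D_def[symmetric])
      (simp add: D_def divide_simps, simp add: algebra_simps power2_eq_square)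
  have hn: "(cmod (h))\<^sup>2 = 1 / D" using 1 n by simp
  show "h\<^sup>2 \<bullet> h\<^sup>2 = 1 / D\<^sup>2"
    using hn by (simp add: dot_square_norm norm_power power_divide)
  show "(\<i> * S * h\<^sup>2) \<bullet> (\<i> * S * h\<^sup>2) = S\<^sup>2 / D\<^sup>2"
    using hn by (simp add: dot_square_norm norm_mult norm_power power_mult_distrib power_divide)
  have "h \<bullet> (\<i> * S * h\<^sup>2) = - S * (h \<bullet> h) * Im (h)"
    by (simp add: inner_complex_def power2_eq_square algebra_simps)
  then show "h \<bullet> (\<i> * S * h\<^sup>2) = S\<^sup>2 * s / D\<^sup>2"
    unfolding 1 by (simp add: h_def Re_Im_whitney_factor D_def power2_eq_square)
  have "(\<i> * S * h\<^sup>2) \<bullet> (\<i> * h) = S * (h \<bullet> h) * Re (h)"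
    by (simp add: inner_complex_def power2_eq_square algebra_simps)
  then show "(\<i> * S * h\<^sup>2) \<bullet> (\<i> * h) = S * C / D\<^sup>2"
    unfolding 1 by (simp add: h_def Re_Im_whitney_factor D_def power2_eq_square)
qed

lemma sphere_whitney_conclusion:
  fixes x :: "'n::finite real_space \<Rightarrow> 'n complex_space"
  assumes "sphere_contact_whitney_sphere a x" "a > 0" "CARD('n) \<ge> 2"
  shows "\<not> constant_sectional_curvature (pullback unit_sphere x (metric (sphere_model a))) \<and>
    conformally_equivalent_to_round (pullback unit_sphere x (metric (sphere_model a)))"
proof -
  obtain \<theta> where \<theta>: "\<theta> > 0" and cong: "congruent_on_sphere (sphere_model a) (sphere_whitney \<theta>) x"
    using assms(1) by (auto simp: sphere_contact_whitney_sphere_def)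
  define C S where "C = cosh \<theta>" and "S = sinh \<theta>"
  have C: "C > 0" and S: "S > 0" using \<theta> by (simp_all add: C_def S_def)
  have CS: "C\<^sup>2 = 1 + S\<^sup>2" unfolding C_def S_def by (simp add: cosh_square_eq)
  define D where "D s = C\<^sup>2 + S\<^sup>2 * s\<^sup>2" for s
  have D: "D s > 0" for s using C by (simp add: D_def add_pos_nonneg)
  define h where "h = whitney_factor C S"
  note hs = whitney_factor_inner[OF C, of S, folded D_def h_def]
  define k where "k s = Complex S (C * s) * h s" for s
  have psi: "sphere_whitney \<theta> (v, s) = (real_tensor v (h s), k s)" for v :: "real^'n" and s
    by (simp add: sphere_whitney_eq h_def k_def C_def S_def)
  have h: "(h has_vector_derivative - (\<i> * S * (h s)\<^sup>2)) (at s)" for s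
    unfolding h_def using C by (intro has_vector_derivative_whitney_factor) simp
  \<comment> \<open>With e = C + i S s and h = 1/e, the quotient rule has numerator i (C e - S (S +
    i C s)) = i (C^2 - S^2) = i.\<close>
  have k: "(k has_vector_derivative \<i> * (h s)\<^sup>2) (at s)" for s
  proof -
    have "((\<lambda>s. of_real S + of_real s * (\<i> * of_real C)) has_derivative
        (\<lambda>x. 0 + of_real x * (\<i> * of_real C))) (at s)"
      by (intro has_derivative_add has_derivative_const has_derivative_mult_left
          has_derivative_of_real has_derivative_ident)
    from has_derivative_mult[OF this h[of s, unfolded has_vector_derivative_def]]
    have "(k has_derivative (\<lambda>x. (of_real S + of_real s * (\<i> * of_real C)) * (x *\<^sub>R - (\<i> * S * (h s)\<^sup>2))
        + (0 + of_real x * (\<i> * of_real C)) * h s)) (at s)"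
      by (simp add: k_def[abs_def] Complex_eq mult_ac)
    moreover have e: "(of_real S + of_real s * (\<i> * of_real C)) * - (\<i> * S * (h s)\<^sup>2)
        + \<i> * of_real C * h s = \<i> * (h s)\<^sup>2"
    proof -
      have "Complex C (S * s) * h s = 1"
        using C by (simp add: h_def whitney_factor_def complex_eq_iff)
      then have "\<i> * of_real C * h s = \<i> * of_real C * (of_real C + \<i> * of_real S * of_real s) * (h s)\<^sup>2"
        by (simp add: Complex_eq power2_eq_square mult.assoc)
      moreover have "complex_of_real C * of_real C = 1 + of_real S * of_real S"
        using CS by (metis of_real_1 of_real_add of_real_mult power2_eq_square)
      ultimately show ?thesis by (simp add: algebra_simps)
    qed
    moreover have "(of_real S + of_real s * (\<i> * of_real C)) * (x *\<^sub>R - (\<i> * S * (h s)\<^sup>2))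
        + (0 + of_real x * (\<i> * of_real C)) * h s = x *\<^sub>R (\<i> * (h s)\<^sup>2)" for x
      unfolding e[symmetric] by (simp add: scaleR_conv_of_real algebra_simps)
    ultimately show ?thesis unfolding has_vector_derivative_def by simp
  qed
  show ?thesis
  proof (rule whitney_metric_conclusion[of _ a "C\<^sup>2" "S\<^sup>2"])
    fix v V W :: "real^'n" and s \<sigma> \<tau> :: real
    assume v: "v \<bullet> v = 1 - s\<^sup>2" "v \<bullet> V = - (s * \<sigma>)" "v \<bullet> W = - (s * \<tau>)"
      and p: "(v, s) \<in> unit_sphere" and X: "(V, \<sigma>) \<in> tangent_space unit_sphere (v, s)"
      and Y: "(W, \<tau>) \<in> tangent_space unit_sphere (v, s)"
    define E where "E X = (real_tensor v (snd X *\<^sub>R - (\<i> * S * (h s)\<^sup>2)) + real_tensor (fst X) (h s),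
       snd X *\<^sub>R (\<i> * (h s)\<^sup>2))" for X
    have hE: "(sphere_whitney \<theta> has_derivative E) (at (v, s) within unit_sphere)"
    proof -
      have "sphere_whitney \<theta> = (\<lambda>u :: 'n real_space. (real_tensor (fst u) (h (snd u)), k (snd u)))"
        by (simp add: fun_eq_iff psi)
      then show ?thesis
        using has_derivative_Pair[OF has_derivative_fst_snd[OF bounded_bilinear_real_tensor h]
            has_derivative_snd_compose[OF k]]
        by (simp add: E_def[abs_def])
    qed
    have sq: "Complex S (C * t) \<bullet> Complex S (C * t) = S\<^sup>2 + C\<^sup>2 * t\<^sup>2" for t
      by (simp add: inner_complex_def power2_eq_square)
    have range: "sphere_whitney \<theta> ` (unit_sphere :: 'n real_space set) \<subseteq> points (sphere_model a)"
    proof (rule image_subsetI)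
      fix u :: "'n real_space" assume "u \<in> unit_sphere"
      moreover obtain w t where u: "u = (w, t)" by (cases u)
      ultimately have w: "w \<bullet> w = 1 - t\<^sup>2" by (simp only: u mem_unit_sphere)
      have "k t \<bullet> k t = (S\<^sup>2 + C\<^sup>2 * t\<^sup>2) / D t"
        using hs(1)[of t] sq[of t] by (simp add: k_def dot_square_norm norm_mult power_mult_distrib)
      then have "sphere_whitney \<theta> (w, t) \<bullet> sphere_whitney \<theta> (w, t)
          = (1 - t\<^sup>2) / D t + (S\<^sup>2 + C\<^sup>2 * t\<^sup>2) / D t"
        by (simp add: psi inner_real_tensor w hs(1))
      also have "\<dots> = 1"
        using D[of t] by (simp add: add_divide_distrib[symmetric]) (simp add: D_def CS algebra_simps)
      finally show "sphere_whitney \<theta> u \<in> points (sphere_model a)"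
        by (simp add: u sphere_model_def norm_eq_1)
    qed
    \<comment> \<open>The U part contributes nothing since h is orthogonal to i h; the parts from h'
      and k' cancel. Hence the metric is a times the Euclidean one.\<close>
    have eta: "sphere_eta (sphere_whitney \<theta> (v, s)) (E (U, \<rho>)) = 0" if U: "v \<bullet> U = - (s * \<rho>)" for U \<rho>
    proof -
      have J: "J (sphere_normal (sphere_whitney \<theta> (v, s))) = - (real_tensor v (\<i> * h s), \<i> * k s)"
        by (simp add: J_def sphere_normal_def psi real_tensor_def vec_eq_iff)
      have "(\<i> * (h s)\<^sup>2) \<bullet> (\<i> * k s) = (h s \<bullet> h s) * (h s \<bullet> Complex S (C * s))"
        by (simp add: k_def inner_complex_def power2_eq_square algebra_simps)
      also have "\<dots> = S * C * (1 - s\<^sup>2) / (D s)\<^sup>2"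
        unfolding hs(1) by (simp add: inner_complex_def h_def Re_Im_whitney_factor D_def[symmetric])
          (simp add: algebra_simps power2_eq_square diff_divide_distrib)
      finally have 1: "(\<i> * (h s)\<^sup>2) \<bullet> (\<i> * k s) = S * C * (1 - s\<^sup>2) / (D s)\<^sup>2" .
      have 2: "h s \<bullet> (\<i> * h s) = 0" by (simp add: inner_complex_def)
      have "sphere_eta (sphere_whitney \<theta> (v, s)) (E (U, \<rho>))
          = - (- \<rho> * (1 - s\<^sup>2) * (S * C / (D s)\<^sup>2) + \<rho> * (S * C * (1 - s\<^sup>2) / (D s)\<^sup>2))"
        unfolding sphere_eta_def J E_def
        by (simp add: inner_add_left inner_real_tensor v(1) hs(5) 1 2)
      then show ?thesis by simp
    qed
    have "pullback unit_sphere x (metric (sphere_model a)) (v, s) (V, \<sigma>) (W, \<tau>)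
        = metric (sphere_model a) (sphere_whitney \<theta> (v, s)) (E (V, \<sigma>)) (E (W, \<tau>))"
      by (rule metric_pullback_congruent[OF cong range hE p X Y])
    also have "\<dots> = a * (E (V, \<sigma>) \<bullet> E (W, \<tau>))"
      using eta[OF v(2)] by (simp add: sphere_model_def)
    also have "E (V, \<sigma>) \<bullet> E (W, \<tau>) = (V \<bullet> W) / D s
        + \<sigma> * \<tau> * ((2 * s * (S\<^sup>2 * s) + (1 - s\<^sup>2) * S\<^sup>2 + 1) / (D s)\<^sup>2)"
    proof -
      have 1: "(\<i> * (h s)\<^sup>2) \<bullet> (\<i> * (h s)\<^sup>2) = 1 / (D s)\<^sup>2"
        using hs(2)[of s] by (simp add: dot_square_norm norm_mult)
      show ?thesis
        by (simp add: E_def inner_add_left inner_add_right inner_real_tensor v inner_commute[of V v]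
            inner_commute[of "\<i> * S * (h s)\<^sup>2" "h s"] hs(1,3,4) 1)
           (simp add: algebra_simps add_divide_distrib diff_divide_distrib)
    qed
    also have "2 * s * (S\<^sup>2 * s) + (1 - s\<^sup>2) * S\<^sup>2 + 1 = D s"
      using CS by (simp add: D_def algebra_simps power2_eq_square)
    finally show "pullback unit_sphere x (metric (sphere_model a)) (v, s) (V, \<sigma>) (W, \<tau>)
        = a / (C\<^sup>2 + S\<^sup>2 * s\<^sup>2) * (V \<bullet> W + \<sigma> * \<tau>)"
      using D[of s] unfolding D_def[symmetric]
      by (simp add: power2_eq_square add_divide_distrib algebra_simps)
  qed (use assms C S in simp_all)
qed

subsection \<open>The ball model\<close>

text \<open>\<open>H\<close> is the Hermitian product with z. The double sum is H X times the
  conjugate of H Y, and real parts of such products are real inner products.\<close>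

lemma bergman_metric_eq:
  fixes z X Y :: "complex^'n::finite"
  defines "H \<equiv> \<lambda>X. \<Sum>j\<in>UNIV. cnj (z $ j) * X $ j"
  shows "bergman_metric z X Y = 4 * ((X \<bullet> Y) / (1 - z \<bullet> z) + (H X \<bullet> H Y) / (1 - z \<bullet> z)\<^sup>2)"
proof -
  have Re: "Re (a * cnj b) = a \<bullet> b" for a b by (simp add: inner_complex_def)
  have "(\<Sum>i\<in>UNIV. \<Sum>j\<in>UNIV. z $ i * cnj (z $ j) * X $ j * cnj (Y $ i)) = H X * cnj (H Y)"
    unfolding H_def cnj_sum sum_product
    by (subst sum.swap) (intro sum.cong refl, simp)
  moreover have "Re (\<Sum>i\<in>UNIV. X $ i * cnj (Y $ i)) = X \<bullet> Y"
    unfolding Re_sum Re inner_vec_def ..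
  ultimately show ?thesis
    unfolding bergman_metric_def by (simp add: inner_complex_def dot_square_norm)
qed

lemma hopf_projection_hyperbolic_whitney:
  assumes "\<theta> > 0"
  shows "hopf_projection (hyperbolic_whitney \<theta> (v, s))
    = real_tensor v (whitney_factor (cosh \<theta>) (sinh \<theta>) s)"
proof -
  define C S where "C = cosh \<theta>" and "S = sinh \<theta>"
  have C: "C > 0" and S: "S > 0" using assms by (simp_all add: C_def S_def)
  have CS: "C\<^sup>2 = 1 + S\<^sup>2" by (simp add: C_def S_def cosh_square_eq)
  define P Q where "P = Complex S (C * s)" and "Q = Complex C (S * s)"
  have PQ: "P \<noteq> 0" "Q \<noteq> 0" using C S by (auto simp: P_def Q_def complex_eq_iff)
  have P: "of_real S + \<i> * of_real (C * s) = P" by (simp add: P_def Complex_eq)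
  \<comment> \<open>Together with the denominator P cnj P this makes the last coordinate Q / P;
    dividing v / P by it leaves v / Q.\<close>
  have N: "of_real (S * C * (1 + s\<^sup>2)) - \<i> * of_real s = cnj P * Q"
  proof -
    have "C\<^sup>2 * s = s + S\<^sup>2 * s" unfolding CS by (simp add: distrib_right)
    then show ?thesis by (simp add: complex_eq_iff P_def Q_def algebra_simps power2_eq_square)
  qed
  have E: "of_real (S\<^sup>2 + C\<^sup>2 * s\<^sup>2) = P * cnj P"
    by (simp add: complex_eq_iff P_def algebra_simps power2_eq_square)
  show ?thesis
    unfolding hopf_projection_def hyperbolic_whitney_def C_def[symmetric] S_def[symmetric]
      case_prod_conv P N E whitney_factor_def Q_def[symmetric]
    using PQ by (simp add: vec_eq_iff real_tensor_def scaleR_conv_of_real divide_simps)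
qed

text \<open>Only the ball component of \<psi> is explicit. The Legendrian condition kills
  \<open>ball_eta\<close> on the image of the differential, so the unknown real component never
  enters the induced metric.\<close>

lemma ball_whitney_conclusion:
  fixes x :: "'n::finite real_space \<Rightarrow> 'n ball_space"
  assumes "ball_contact_whitney_sphere a x" "a > 0" "CARD('n) \<ge> 2"
  shows "\<not> constant_sectional_curvature (pullback unit_sphere x (metric (ball_model a))) \<and>
    conformally_equivalent_to_round (pullback unit_sphere x (metric (ball_model a)))"
proof -
  obtain \<theta> \<psi> where \<theta>: "\<theta> > 0" and leg: "legendrian_immersion (ball_model a) \<psi>"
    and psi: "\<And>u. u \<in> unit_sphere \<Longrightarrow> fst (\<psi> u) = hopf_projection (hyperbolic_whitney \<theta> u)"
    and cong: "congruent_on_sphere (ball_model a) \<psi> x"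
    using assms(1) unfolding ball_contact_whitney_sphere_def by metis
  define C S where "C = cosh \<theta>" and "S = sinh \<theta>"
  have C: "C > 0" and S: "S > 0" using \<theta> by (simp_all add: C_def S_def)
  have CS: "C\<^sup>2 = 1 + S\<^sup>2" by (simp add: C_def S_def cosh_square_eq)
  define D where "D s = C\<^sup>2 + S\<^sup>2 * s\<^sup>2" for s
  have D: "D s > 0" for s using C by (simp add: D_def add_pos_nonneg)
  define E where "E s = S\<^sup>2 + C\<^sup>2 * s\<^sup>2" for s
  have E: "E s > 0" for s using S by (simp add: E_def add_pos_nonneg)
  define h where "h = whitney_factor C S"
  note hs = whitney_factor_inner[OF C, of S, folded D_def h_def]
  have fst_psi: "fst (\<psi> (v, s)) = real_tensor v (h s)" if "(v, s) \<in> unit_sphere" for v s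
    using psi[OF that] hopf_projection_hyperbolic_whitney[OF \<theta>] by (simp add: h_def C_def S_def)
  have h: "(h has_vector_derivative - (\<i> * S * (h s)\<^sup>2)) (at s)" for s
    unfolding h_def using C by (intro has_vector_derivative_whitney_factor) simp
  show ?thesis
  proof (rule whitney_metric_conclusion[of _ "4 * a" "S\<^sup>2" "C\<^sup>2"])
    fix v V W :: "real^'n" and s \<sigma> \<tau> :: real
    assume v: "v \<bullet> v = 1 - s\<^sup>2" "v \<bullet> V = - (s * \<sigma>)" "v \<bullet> W = - (s * \<tau>)"
      and p: "(v, s) \<in> unit_sphere" and X: "(V, \<sigma>) \<in> tangent_space unit_sphere (v, s)"
      and Y: "(W, \<tau>) \<in> tangent_space unit_sphere (v, s)"
    define d where "d = differential unit_sphere \<psi> (v, s)"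
    have range: "\<psi> ` unit_sphere \<subseteq> points (ball_model a)" and sm: "smooth_on unit_sphere \<psi>"
      and eta: "\<And>X. X \<in> tangent_space unit_sphere (v, s) \<Longrightarrow> ball_eta (\<psi> (v, s)) (d X) = 0"
      using leg p \<open>a > 0\<close> by (auto simp: legendrian_immersion_def ball_model_def d_def
          simp del: mem_sphere_0)
    have hd: "(\<psi> has_derivative d) (at (v, s) within unit_sphere)"
      using smooth_on_imp_differentiable[OF sm p]
      by (simp add: d_def differential_def frechet_derivative_works)
    define e where "e X = real_tensor v (snd X *\<^sub>R - (\<i> * S * (h s)\<^sup>2)) + real_tensor (fst X) (h s)" for X
    \<comment> \<open>The explicit formula for the ball component holds on the sphere only, so
      \<open>e\<close> and the first part of \<open>d\<close> are compared on tangent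
      vectors.\<close>
    have "((\<lambda>u. fst (\<psi> u)) has_derivative e) (at (v, s) within unit_sphere)"
    proof (rule has_derivative_transform[OF p])
      show "((\<lambda>u. real_tensor (fst u) (h (snd u))) has_derivative e) (at (v, s) within unit_sphere)"
        using has_derivative_fst_snd[OF bounded_bilinear_real_tensor h] by (simp add: e_def[abs_def])
      show "fst (\<psi> u) = real_tensor (fst u) (h (snd u))" if "u \<in> unit_sphere" for u
        using fst_psi[of "fst u" "snd u"] that by simp
    qed
    moreover have "((\<lambda>u. fst (\<psi> u)) has_derivative (\<lambda>X. fst (d X))) (at (v, s) within unit_sphere)"
      using has_derivative_fst[OF hd] .
    ultimately have fst_d: "fst (d X) = e X" if "X \<in> tangent_space unit_sphere (v, s)" for X
      using differential_eq that by metis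
    define z where "z = fst (\<psi> (v, s))"
    have z: "z = real_tensor v (h s)" unfolding z_def by (rule fst_psi[OF p])
    \<comment> \<open>Dividing 1/D by this leaves 1/E, which exchanges cosh and sinh relative to the
      spherical case.\<close>
    have zz: "1 - z \<bullet> z = E s / D s"
    proof -
      have "1 - z \<bullet> z = (D s - (1 - s\<^sup>2)) / D s"
        using D[of s] by (simp add: z inner_real_tensor v(1) hs(1) diff_divide_distrib)
      also have "D s - (1 - s\<^sup>2) = E s"
        by (simp add: D_def E_def CS algebra_simps)
      finally show ?thesis .
    qed
    \<comment> \<open>For tangent vectors v \<bullet> U = - s \<rho>, so the Hermitian product of z
      with the derivative depends on the last component \<rho> alone; q is its coefficient.\<close>
    define q where "q = cnj (h s) * ((1 - s\<^sup>2) *\<^sub>R - (\<i> * S * (h s)\<^sup>2) - s *\<^sub>R h s)"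
    have H: "(\<Sum>j\<in>UNIV. cnj (z $ j) * e (U, \<rho>) $ j) = \<rho> *\<^sub>R q" if "v \<bullet> U = - (s * \<rho>)" for U \<rho>
    proof -
      have "(\<Sum>j\<in>UNIV. cnj (z $ j) * e (U, \<rho>) $ j)
          = (v \<bullet> v) *\<^sub>R (cnj (h s) * (\<rho> *\<^sub>R - (\<i> * S * (h s)\<^sup>2))) + (v \<bullet> U) *\<^sub>R (cnj (h s) * h s)"
        unfolding inner_vec_def scaleR_sum_left sum.distrib[symmetric]
        by (intro sum.cong refl)
           (simp add: z e_def real_tensor_def scaleR_conv_of_real algebra_simps)
      then show ?thesis
        unfolding v(1) that by (simp add: q_def scaleR_conv_of_real algebra_simps)
    qed
    have qq: "q \<bullet> q = E s / D s ^ 3"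
    proof -
      have "q \<bullet> q = (h s \<bullet> h s) * (((1 - s\<^sup>2) *\<^sub>R - (\<i> * S * (h s)\<^sup>2) - s *\<^sub>R h s)
          \<bullet> ((1 - s\<^sup>2) *\<^sub>R - (\<i> * S * (h s)\<^sup>2) - s *\<^sub>R h s))"
        by (simp add: q_def dot_square_norm norm_mult power_mult_distrib)
      also have "\<dots> = (1 / D s) * ((1 - s\<^sup>2)\<^sup>2 * (S\<^sup>2 / (D s)\<^sup>2) + s\<^sup>2 * (1 / D s)
          + 2 * s * (1 - s\<^sup>2) * (S\<^sup>2 * s / (D s)\<^sup>2))"
        unfolding inner_diff_left inner_diff_right inner_scaleR_left inner_scaleR_right
          inner_minus_left inner_minus_right hs inner_commute[of "\<i> * S * (h s)\<^sup>2" "h s"]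
        by (simp add: algebra_simps power2_eq_square add_divide_distrib diff_divide_distrib)
      also have "\<dots> = ((1 - s\<^sup>2)\<^sup>2 * S\<^sup>2 + s\<^sup>2 * D s + 2 * s\<^sup>2 * (1 - s\<^sup>2) * S\<^sup>2) / D s ^ 3"
        using D[of s] by (simp add: divide_simps) (simp add: algebra_simps eval_nat_numeral)
      also have "(1 - s\<^sup>2)\<^sup>2 * S\<^sup>2 + s\<^sup>2 * D s + 2 * s\<^sup>2 * (1 - s\<^sup>2) * S\<^sup>2 = E s"
        by (simp add: D_def E_def algebra_simps power2_eq_square)
      finally show ?thesis .
    qed
    have ee: "e (V, \<sigma>) \<bullet> e (W, \<tau>) = (V \<bullet> W) / D s + \<sigma> * \<tau> * (S\<^sup>2 * (1 + s\<^sup>2) / (D s)\<^sup>2)"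
      by (simp add: e_def inner_add_left inner_add_right inner_real_tensor v inner_commute[of V v]
          inner_commute[of "\<i> * S * (h s)\<^sup>2" "h s"] hs(1,3,4))
         (simp add: algebra_simps add_divide_distrib diff_divide_distrib power2_eq_square)
    have "pullback unit_sphere x (metric (ball_model a)) (v, s) (V, \<sigma>) (W, \<tau>)
        = metric (ball_model a) (\<psi> (v, s)) (d (V, \<sigma>)) (d (W, \<tau>))"
      by (rule metric_pullback_congruent[OF cong range hd p X Y])
    also have "\<dots> = a * bergman_metric z (e (V, \<sigma>)) (e (W, \<tau>))"
      using eta[OF X] fst_d[OF X] fst_d[OF Y] by (simp add: ball_model_def z_def)
    also have "\<dots> = 4 * a * (((V \<bullet> W) / D s + \<sigma> * \<tau> * (S\<^sup>2 * (1 + s\<^sup>2) / (D s)\<^sup>2)) / (E s / D s)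
        + \<sigma> * \<tau> * (E s / D s ^ 3) / (E s / D s)\<^sup>2)"
      unfolding bergman_metric_eq H[OF v(2)] H[OF v(3)] zz ee by (simp add: qq)
    \<comment> \<open>The Hermitian term contributes exactly 1 / (D E), which completes the
      numerator to D and yields the common factor 1/E.\<close>
    also have "\<dots> = 4 * a * ((V \<bullet> W) / E s + \<sigma> * \<tau> * ((S\<^sup>2 * (1 + s\<^sup>2) + 1) / (D s * E s)))"
      using D[of s] E[of s] by (simp add: divide_simps) (simp add: algebra_simps eval_nat_numeral)
    also have "S\<^sup>2 * (1 + s\<^sup>2) + 1 = D s"
      by (simp add: D_def CS algebra_simps)
    finally show "pullback unit_sphere x (metric (ball_model a)) (v, s) (V, \<sigma>) (W, \<tau>)
        = 4 * a / (S\<^sup>2 + C\<^sup>2 * s\<^sup>2) * (V \<bullet> W + \<sigma> * \<tau>)"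
      using D[of s] by (simp add: E_def[symmetric] add_divide_distrib algebra_simps)
  qed (use assms C S in simp_all)
qed

theorem theorem4p1:
  fixes c :: real
  assumes "CARD('n::finite) \<ge> 2"
  shows
    "(c = -3 \<longrightarrow>
        (\<forall>x :: 'n real_space \<Rightarrow> 'n flat_space. flat_contact_whitney_sphere x \<longrightarrow>
           \<not> constant_sectional_curvature (pullback unit_sphere x (metric flat_model)) \<and>
           conformally_equivalent_to_round (pullback unit_sphere x (metric flat_model)))) \<and>
     (\<forall>a>0. c = 4 / a - 3 \<longrightarrow>
        (\<forall>x :: 'n real_space \<Rightarrow> 'n complex_space. sphere_contact_whitney_sphere a x \<longrightarrow>
           \<not> constant_sectional_curvature (pullback unit_sphere x (metric (sphere_model a))) \<and>
           conformally_equivalent_to_round (pullback unit_sphere x (metric (sphere_model a))))) \<and>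
     (\<forall>a>0. c = - (1 / a) - 3 \<longrightarrow>
        (\<forall>x :: 'n real_space \<Rightarrow> 'n ball_space. ball_contact_whitney_sphere a x \<longrightarrow>
           \<not> constant_sectional_curvature (pullback unit_sphere x (metric (ball_model a))) \<and>
           conformally_equivalent_to_round (pullback unit_sphere x (metric (ball_model a)))))"
  using flat_whitney_conclusion sphere_whitney_conclusion ball_whitney_conclusion assms
  by (intro conjI allI impI) blast+

end
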